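(* Let $n \ge 3$ be an integer, let $K$ be a field of prime characteristic $p$ with $p \nmid n$, and let $R = K[X_1, \dots, X_n]/(X_1^n + \dots + X_n^n)$. Let $x_i$ denote the image of $X_i$ in $R$. Then $$(x_1 \dotsm x_n)^{n-2} \in (x_1^{n-1}, \dots, x_n^{n-1})^F$$ if and only if $p \not\equiv 1 \bmod n$, where $^F$ denotes Frobenius closure of ideals of $R$.
   Context: Let $R$ be a Noetherian ring of prime characteristic $p>0$. For an ideal $I = (a_1, \dots, a_t) \subseteq R$ and $q = p^e$ with $e$ a nonnegative integer, put $I^{[q]} = (a_1^q, \dots, a_t^q)$. An element $x \in R$ is in the Frobenius closure $I^F$ of $I$ if there exists $q = p^e$ such that $x^q \in I^{[q]}$. *)

theory Defs
  imports
    "HOL-Algebra.QuotRing"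
    "HOL-Decision_Procs.Algebra_Aux"
    "HOL-Library.Cardinality"
    "HOL-Library.Poly_Mapping"
    "HOL-Number_Theory.Cong"
begin

section \<open>Frobenius powers and Frobenius closure\<close>

text \<open>
  The Frobenius power of the ideal generated by \<open>A\<close>, as a function of the generators.
  In a commutative ring of prime characteristic \<open>p\<close>, and for \<open>q\<close> a power of \<open>p\<close>, it only
  depends on the ideal: see \<open>frobenius_power_cong\<close> below.
\<close>

definition frobenius_power :: "('a, 'b) ring_scheme \<Rightarrow> nat \<Rightarrow> 'a set \<Rightarrow> 'a set"
  where "frobenius_power R q A = Idl\<^bsub>R\<^esub> ((\<lambda>a. a [^]\<^bsub>R\<^esub> q) ` A)"

text \<open>
  The parameter \<open>p\<close> is meant to be the (prime) characteristic of \<open>R\<close>. The choice of the finite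
  generating set \<open>A\<close> is immaterial: see \<open>mem_frobenius_closure_Idl_iff\<close> below.
\<close>

definition frobenius_closure :: "('a, 'b) ring_scheme \<Rightarrow> nat \<Rightarrow> 'a set \<Rightarrow> 'a set"
  where "frobenius_closure R p I =
    {x \<in> carrier R. \<exists>A e. finite A \<and> A \<subseteq> carrier R \<and> I = Idl\<^bsub>R\<^esub> A \<and>
       x [^]\<^bsub>R\<^esub> (p ^ e) \<in> frobenius_power R (p ^ e) A}"


section \<open>The Fermat ring\<close>

text \<open>
  \<open>K[X\<^sub>i | i \<in> 'n]\<close>, where the field \<open>K\<close> is the type \<open>'k\<close>; exponent vectors are finitely
  supported functions \<open>'n \<Rightarrow>\<^sub>0 nat\<close>.
\<close>

type_synonym ('n, 'k) mpoly = "('n \<Rightarrow>\<^sub>0 nat) \<Rightarrow>\<^sub>0 'k"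

definition mpoly_var :: "'n \<Rightarrow> ('n, 'k::field) mpoly"
  where "mpoly_var i = Poly_Mapping.single (Poly_Mapping.single i 1) 1"

abbreviation mpoly_ring :: "('n, 'k::field) mpoly ring"
  where "mpoly_ring \<equiv> cring_class_ops"

definition fermat_poly :: "('n::finite, 'k::field) mpoly"
  where "fermat_poly = (\<Sum>i\<in>UNIV. mpoly_var i ^ CARD('n))"

definition fermat_ideal :: "('n::finite, 'k::field) mpoly set"
  where "fermat_ideal = Idl\<^bsub>mpoly_ring\<^esub> {fermat_poly}"

definition fermat_ring :: "('n::finite, 'k::field) mpoly set ring"
  where "fermat_ring = mpoly_ring Quot fermat_ideal"

definition fermat_var :: "'n::finite \<Rightarrow> ('n, 'k::field) mpoly set"
  where "fermat_var i = fermat_ideal +>\<^bsub>mpoly_ring\<^esub> mpoly_var i"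


section \<open>Independence of the generating set\<close>

lemma (in cring) binomial_ring:
  assumes x: "x \<in> carrier R" and y: "y \<in> carrier R"
  shows "(x \<oplus> y) [^] (n::nat) =
    (\<Oplus>k\<in>{..n}. [(n choose k)] \<cdot> (x [^] k \<otimes> y [^] (n - k)))"
proof (induction n)
  case 0
  show ?case using x y by simp
next
  case (Suc n)
  define t where "t m k = x [^] k \<otimes> y [^] (m - k)" for m k :: nat
  have t [simp]: "t m k \<in> carrier R" for m k
    using x y by (simp add: t_def)
  have tx: "x \<otimes> t n k = t (Suc n) (Suc k)" for k
    using x y unfolding t_def by (simp add: m_ac)
  have ty: "y \<otimes> t n k = t (Suc n) k" if "k \<le> n" for k
    using x y that unfolding t_def by (simp add: Suc_diff_le m_ac)
  have "(x \<oplus> y) [^] Suc n = (\<Oplus>k\<in>{..n}. [(n choose k)] \<cdot> t n k) \<otimes> (x \<oplus> y)"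
    using Suc.IH by (simp add: t_def)
  also have "\<dots> = (\<Oplus>k\<in>{..n}. [(n choose k)] \<cdot> t n k \<otimes> (x \<oplus> y))"
    using x y by (intro finsum_ldistr) auto
  also have "\<dots> = (\<Oplus>k\<in>{..n}. [(n choose k)] \<cdot> t (Suc n) (Suc k) \<oplus> [(n choose k)] \<cdot> t (Suc n) k)"
  proof (rule finsum_cong', goal_cases)
    case (3 k)
    have "t n k \<otimes> (x \<oplus> y) = t (Suc n) (Suc k) \<oplus> t (Suc n) k"
      using x y 3 tx[of k] ty[of k] by (simp add: r_distr m_comm)
    then show ?case
      using x y by (simp add: add_pow_ldistr add.nat_pow_distrib)
  qed auto
  also have "\<dots> = (\<Oplus>k\<in>{..n}. [(n choose k)] \<cdot> t (Suc n) (Suc k))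
      \<oplus> (\<Oplus>k\<in>{..n}. [(n choose k)] \<cdot> t (Suc n) k)"
    by (intro finsum_addf) auto
  also have "(\<Oplus>k\<in>{..n}. [(n choose k)] \<cdot> t (Suc n) k)
      = (\<Oplus>k\<in>{..Suc n}. [(n choose k)] \<cdot> t (Suc n) k)"
    by (subst finsum_Suc) (auto simp: binomial_eq_0)
  also have "\<dots> = (\<Oplus>k\<in>{..n}. [(n choose Suc k)] \<cdot> t (Suc n) (Suc k)) \<oplus> t (Suc n) 0"
    by (subst finsum_Suc2) auto
  also have "(\<Oplus>k\<in>{..n}. [(n choose k)] \<cdot> t (Suc n) (Suc k)) \<oplus>
        ((\<Oplus>k\<in>{..n}. [(n choose Suc k)] \<cdot> t (Suc n) (Suc k)) \<oplus> t (Suc n) 0)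
      = (\<Oplus>k\<in>{..n}. [(n choose k)] \<cdot> t (Suc n) (Suc k) \<oplus> [(n choose Suc k)] \<cdot> t (Suc n) (Suc k))
        \<oplus> t (Suc n) 0"
    by (subst finsum_addf) (auto simp: a_assoc)
  also have "\<dots> = (\<Oplus>k\<in>{..n}. [(Suc n choose Suc k)] \<cdot> t (Suc n) (Suc k)) \<oplus> t (Suc n) 0"
    by (simp add: add.nat_pow_mult)
  also have "\<dots> = (\<Oplus>k\<in>{..Suc n}. [(Suc n choose k)] \<cdot> t (Suc n) k)"
    by (subst finsum_Suc2) auto
  finally show ?case by (simp add: t_def)
qed

lemma (in cring) add_pow_char_dvd:
  assumes "[p] \<cdot> \<one> = \<zero>" "p dvd (m::nat)" "z \<in> carrier R"
  shows "[m] \<cdot> z = \<zero>"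
proof -
  obtain l where "m = p * l" using assms(2) by blast
  have "[p] \<cdot> z = ([p] \<cdot> \<one>) \<otimes> z"
    using assms(3) by (simp add: add_pow_ldistr)
  then have "[p] \<cdot> z = \<zero>" using assms by simp
  then show ?thesis
    using assms(3) add.nat_pow_pow[of z l p] \<open>m = p * l\<close> by (simp add: mult.commute)
qed

lemma (in cring) freshmans_dream_ring:
  assumes "prime p" "[p] \<cdot> \<one> = \<zero>" "x \<in> carrier R" "y \<in> carrier R"
  shows "(x \<oplus> y) [^] p = x [^] p \<oplus> y [^] (p::nat)"
proof -
  obtain r where r: "p = Suc (Suc r)"
    using prime_ge_2_nat[OF assms(1)] by (metis add_2_eq_Suc le_Suc_ex)
  define f where "f k = [(p choose k)] \<cdot> (x [^] k \<otimes> y [^] (p - k))" for k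
  have f [simp]: "f k \<in> carrier R" for k using assms(3,4) by (simp add: f_def)
  have z: "f (Suc k) = \<zero>" if "k \<le> r" for k
    unfolding f_def
  proof (rule add_pow_char_dvd[OF assms(2)])
    show "p dvd (p choose Suc k)"
      by (rule dvd_choose_prime) (use assms(1) that r in auto)
    show "x [^] Suc k \<otimes> y [^] (p - Suc k) \<in> carrier R"
      using assms(3,4) by blast
  qed
  have "(\<Oplus>k\<in>{..r}. f (Suc k)) = \<zero>"
    using z by (intro add.finprod_one_eqI) simp
  moreover have "(\<Oplus>k\<in>{..Suc (Suc r)}. f k) = f (Suc (Suc r)) \<oplus> ((\<Oplus>k\<in>{..r}. f (Suc k)) \<oplus> f 0)"
    by (subst finsum_Suc, simp, subst finsum_Suc2) auto
  ultimately have "(\<Oplus>k\<in>{..p}. f k) = f p \<oplus> f 0"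
    using r by simp
  moreover have "f p = x [^] p" and "f 0 = y [^] p"
    using assms(3,4) by (simp_all add: f_def)
  ultimately show ?thesis
    using binomial_ring[OF assms(3,4), of p] by (simp add: f_def)
qed

lemma (in cring) freshmans_dream_ring':
  assumes "prime p" "[p] \<cdot> \<one> = \<zero>" "x \<in> carrier R" "y \<in> carrier R"
  shows "(x \<oplus> y) [^] (p ^ e) = x [^] (p ^ e) \<oplus> y [^] ((p::nat) ^ e)"
proof (induction e)
  case (Suc e)
  have "z [^] (p ^ Suc e) = (z [^] (p ^ e)) [^] p" if "z \<in> carrier R" for z
    using that by (simp add: nat_pow_pow mult.commute)
  then show ?case
    using assms Suc by (simp add: freshmans_dream_ring del: power_Suc)
qed (use assms in auto)

lemma (in cring) frobenius_power_mono:
  assumes "prime p" "[p] \<cdot> \<one> = \<zero>" "A \<subseteq> carrier R" "B \<subseteq> carrier R" "A \<subseteq> Idl B"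
  shows "frobenius_power R ((p::nat) ^ e) A \<subseteq> frobenius_power R (p ^ e) B"
proof -
  let ?J = "frobenius_power R (p ^ e) B"
  let ?S = "{x \<in> carrier R. x [^] (p ^ e) \<in> ?J}"
  have sub: "(\<lambda>a. a [^] (p ^ e)) ` B \<subseteq> carrier R" using assms by auto
  have J: "ideal ?J R"
    unfolding frobenius_power_def by (rule genideal_ideal[OF sub])
  interpret J: ideal ?J R by (rule J)
  have q: "p ^ e > 0" using prime_gt_0_nat[OF assms(1)] by simp
  have mul: "y \<otimes> x \<in> ?S" if "x \<in> ?S" "y \<in> carrier R" for x y
    using that by (auto simp: nat_pow_distrib intro: J.I_l_closed)
  have "ideal ?S R"
  proof (rule idealI[OF ring_axioms])
    show "subgroup ?S (add_monoid R)"
    proof (rule add.subgroupI)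
      have "\<zero> \<in> ?S" using q by (simp add: nat_pow_zero)
      then show "?S \<noteq> {}" by blast
    next
      fix a assume a: "a \<in> ?S"
      have "\<ominus> a = \<ominus> \<one> \<otimes> a" using a by (simp add: l_minus)
      then show "\<ominus> a \<in> ?S" using mul[of a "\<ominus> \<one>"] a by simp
    next
      fix a b assume "a \<in> ?S" "b \<in> ?S"
      then show "a \<oplus> b \<in> ?S"
        using assms by (simp add: freshmans_dream_ring')
    qed auto
    show "x \<otimes> a \<in> ?S" if "a \<in> ?S" "x \<in> carrier R" for a x
      using mul that .
    show "a \<otimes> x \<in> ?S" if "a \<in> ?S" "x \<in> carrier R" for a x
      using mul[OF that] that by (simp add: m_comm)
  qed
  moreover have "B \<subseteq> ?S"
    using assms(4) genideal_self[OF sub] by (auto simp: frobenius_power_def)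
  ultimately have "Idl B \<subseteq> ?S" by (rule genideal_minimal)
  then have "(\<lambda>a. a [^] (p ^ e)) ` A \<subseteq> ?J" using assms(5) by auto
  then show ?thesis
    unfolding frobenius_power_def[of R _ A] by (rule genideal_minimal[OF J])
qed

lemma (in cring) frobenius_power_cong:
  assumes "prime p" "[p] \<cdot> \<one> = \<zero>" "A \<subseteq> carrier R" "B \<subseteq> carrier R" "Idl A = Idl B"
  shows "frobenius_power R ((p::nat) ^ e) A = frobenius_power R (p ^ e) B"
proof
  show "frobenius_power R (p ^ e) A \<subseteq> frobenius_power R (p ^ e) B"
    using genideal_self[OF assms(3)] assms by (intro frobenius_power_mono) auto
  show "frobenius_power R (p ^ e) B \<subseteq> frobenius_power R (p ^ e) A"
    using genideal_self[OF assms(4)] assms by (intro frobenius_power_mono) auto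
qed

lemma (in cring) mem_frobenius_closure_Idl_iff:
  assumes "prime p" "[p] \<cdot> \<one> = \<zero>" "finite A" "A \<subseteq> carrier R"
  shows "x \<in> frobenius_closure R p (Idl A) \<longleftrightarrow>
    x \<in> carrier R \<and> (\<exists>e. x [^] ((p::nat) ^ e) \<in> frobenius_power R (p ^ e) A)"
proof
  assume "x \<in> frobenius_closure R p (Idl A)"
  then obtain B e where "x \<in> carrier R" "B \<subseteq> carrier R" "Idl A = Idl B"
      "x [^] (p ^ e) \<in> frobenius_power R (p ^ e) B"
    unfolding frobenius_closure_def by auto
  moreover from this have "frobenius_power R (p ^ e) A = frobenius_power R (p ^ e) B"
    by (intro frobenius_power_cong assms)
  ultimately show "x \<in> carrier R \<and> (\<exists>e. x [^] (p ^ e) \<in> frobenius_power R (p ^ e) A)"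
    by auto
next
  assume "x \<in> carrier R \<and> (\<exists>e. x [^] (p ^ e) \<in> frobenius_power R (p ^ e) A)"
  then show "x \<in> frobenius_closure R p (Idl A)"
    unfolding frobenius_closure_def using assms by auto
qed


section \<open>Basic facts about the Fermat ring\<close>

lemma cring_mpoly_ring: "cring (mpoly_ring :: ('n, 'k::field) mpoly ring)"
  by (rule cring_class)

lemma ideal_fermat_ideal: "ideal (fermat_ideal :: ('n::finite, 'k::field) mpoly set) mpoly_ring"
  unfolding fermat_ideal_def by (rule ring.genideal_ideal[OF cring_class.ring_axioms]) (simp add: carrier_class)

lemma cring_fermat_ring: "cring (fermat_ring :: ('n::finite, 'k::field) mpoly set ring)"
  unfolding fermat_ring_def by (rule ideal.quotient_is_cring[OF ideal_fermat_ideal cring_mpoly_ring])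

lemma fermat_var_closed: "fermat_var i \<in> carrier fermat_ring"
  unfolding fermat_var_def fermat_ring_def FactRing_def A_RCOSETS_def'
  by (auto simp: cring_class_ops_def a_r_coset_def)

lemma fermat_ring_char:
  "[CHAR('k)] \<cdot>\<^bsub>fermat_ring\<^esub> \<one>\<^bsub>fermat_ring\<^esub> = \<zero>\<^bsub>(fermat_ring :: ('n::finite, 'k::field) mpoly set ring)\<^esub>"
proof -
  let ?P = "mpoly_ring :: ('n, 'k) mpoly ring" and ?R = "fermat_ring :: ('n, 'k) mpoly set ring"
  let ?h = "\<lambda>f :: ('n, 'k) mpoly. fermat_ideal +>\<^bsub>?P\<^esub> f"
  have h: "?h \<in> ring_hom ?P ?R"
    unfolding fermat_ring_def by (rule ideal.rcos_ring_hom[OF ideal_fermat_ideal])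
  have zero: "?h 0 = \<zero>\<^bsub>?R\<^esub>"
    using ring_hom_zero[OF h cring_class.ring_axioms cring.axioms(1)[OF cring_fermat_ring]]
    by (simp add: zero_class)
  have add: "?h (f + g) = ?h f \<oplus>\<^bsub>?R\<^esub> ?h g" for f g
    using ring_hom_add[OF h, of f g] by (simp add: carrier_class plus_class)
  have one: "?h 1 = \<one>\<^bsub>?R\<^esub>"
    using ring_hom_one[OF h] by (simp add: one_class)
  have pow: "?h (of_nat m) = [m] \<cdot>\<^bsub>?R\<^esub> \<one>\<^bsub>?R\<^esub>" for m :: nat
  proof (induction m)
    case 0
    show ?case by (simp add: zero add_pow_def)
  next
    case (Suc m)
    have "?h (of_nat (Suc m)) = ?h (of_nat m) \<oplus>\<^bsub>?R\<^esub> ?h 1"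
      by (simp add: add[symmetric] add.commute)
    also have "\<dots> = [Suc m] \<cdot>\<^bsub>?R\<^esub> \<one>\<^bsub>?R\<^esub>"
      unfolding Suc.IH one by (simp add: add_pow_def)
    finally show ?case .
  qed
  have "(of_nat CHAR('k) :: ('n, 'k) mpoly) = 0"
    using of_nat_CHAR[where ?'a = 'k] by (metis single_of_nat single_zero)
  then show ?thesis
    using pow[of "CHAR('k)"] zero by simp
qed

end

theory Submission
  imports Defs "HOL-Number_Theory.Number_Theory"
begin

text \<open>
  Write \<open>F\<close> for the Fermat polynomial. If \<open>p\<close> is \<open>1\<close> modulo \<open>n\<close> and \<open>q = p^e = n m + 1\<close>, then a
  representation of \<open>(X\<^sub>1 \<dots> X\<^sub>n)^((n-2)q)\<close> in the ideal generated by \<open>F\<close> and the \<open>X\<^sub>i^((n-1)q)\<close>,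
  multiplied by \<open>F^(q-1)\<close>, is impossible: the monomial \<open>(X\<^sub>1 \<dots> X\<^sub>n)^((n-1)q-1)\<close> has as coefficient the
  multinomial coefficient \<open>(n m)! / m!^n\<close>, which is nonzero modulo \<open>p\<close> since all base-\<open>p\<close> digits of \<open>m\<close>
  are \<open>(p-1)/n\<close>.

  Otherwise take \<open>q = p^e = n m + 1\<close> for a suitable \<open>e > 0\<close>, and put \<open>Y\<^sub>i = X\<^sub>i^n\<close>. Modulo \<open>F\<close> one may
  replace one of the variables \<open>Y\<^sub>i\<close> by \<open>-L\<close>, where \<open>L\<close> is the sum of the other \<open>n - 1\<close>. With
  \<open>a = (n-2) m\<close> and \<open>b = (n-1) m + 1 = q - m\<close> it suffices that \<open>P = (L \<Prod>Y\<^sub>i)^a\<close> lies in the ideal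
  generated by \<open>L^b\<close> and the \<open>Y\<^sub>i^b\<close>. A linear functional \<open>\<phi>\<close> vanishing on this ideal is, in the degree
  of \<open>P\<close>, given by the coefficient of \<open>\<Prod>Y\<^sub>i^(q-1)\<close> in the product with a form \<open>h\<close> of degree \<open>q - 1\<close>.
  The annihilation conditions say that \<open>Y\<^sub>i^m\<close> and \<open>L^m\<close> divide \<open>h\<close>, so \<open>h\<close> is a multiple of
  \<open>(L \<Prod>Y\<^sub>i)^m\<close>, and \<open>\<phi> P\<close> is a multiple of the coefficient of \<open>\<Prod>Y\<^sub>i^m\<close> in \<open>L^((n-1)m)\<close>. This
  multinomial coefficient vanishes modulo \<open>p\<close>, because without a carry in the last base-\<open>p\<close> digit \<open>n\<close>
  would divide \<open>p - 1\<close>.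
\<close>

abbreviation "lookup \<equiv> Poly_Mapping.lookup"
abbreviation "single \<equiv> Poly_Mapping.single"
abbreviation "keys \<equiv> Poly_Mapping.keys"

section \<open>Coefficients of products\<close>

lemma lookup_single_mult_add:
  fixes f :: "('n \<Rightarrow>\<^sub>0 nat) \<Rightarrow>\<^sub>0 'a::comm_semiring_1"
  shows "lookup (single v c * f) (v + w) = c * lookup f w"
proof -
  have "(\<Sum>l. lookup (single v c) l * (\<Sum>q. lookup f q when v + w = l + q))
      = (\<Sum>l. (c * (\<Sum>q. lookup f q when v + w = v + q)) when l = v)"
    by (rule Sum_any.cong) (auto simp: lookup_single when_def)
  then show ?thesis
    by (simp add: lookup_mult)
qed

lemma lookup_single_mult_eq_0:
  fixes f :: "('n \<Rightarrow>\<^sub>0 nat) \<Rightarrow>\<^sub>0 'a::comm_semiring_1"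
  assumes "\<nexists>w. u = v + w"
  shows "lookup (single v c * f) u = 0"
  using keys_mult[of "single v c" f] assms
  by (auto simp: in_keys_iff split: if_splits)

lemma poly_mapping_eq_sum_single:
  "f = (\<Sum>u\<in>keys f. single u (lookup f u))"
proof (rule poly_mapping_eqI)
  fix k
  have "lookup (\<Sum>u\<in>keys f. single u (lookup f u)) k = (\<Sum>u\<in>keys f. if u = k then lookup f u else 0)"
    by (auto simp: lookup_sum lookup_single when_def intro!: sum.cong)
  then show "lookup f k = lookup (\<Sum>u\<in>keys f. single u (lookup f u)) k"
    by (simp add: in_keys_iff)
qed

lemma lookup_le_add_diff:
  assumes "\<And>i. lookup v i \<le> lookup u i"
  shows "v + (u - v) = (u :: 'n \<Rightarrow>\<^sub>0 nat)"
  by (rule poly_mapping_eqI) (simp add: lookup_add lookup_minus assms)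

text \<open>Convolution over the support of the first factor only. The guard makes the truncated
  difference \<open>u - v\<close> the true complementary exponent.\<close>

lemma lookup_mult_sum_keys:
  fixes f g :: "('n \<Rightarrow>\<^sub>0 nat) \<Rightarrow>\<^sub>0 'a::comm_semiring_1"
  shows "lookup (f * g) u =
    (\<Sum>v\<in>keys f. if \<forall>i. lookup v i \<le> lookup u i then lookup f v * lookup g (u - v) else 0)"
proof -
  have "lookup (f * g) u = lookup ((\<Sum>v\<in>keys f. single v (lookup f v)) * g) u"
    by (simp add: poly_mapping_eq_sum_single[symmetric])
  also have "\<dots> = (\<Sum>v\<in>keys f. lookup (single v (lookup f v) * g) u)"
    by (simp add: sum_distrib_right lookup_sum)
  also have "\<dots> = (\<Sum>v\<in>keys f. if \<forall>i. lookup v i \<le> lookup u i then lookup f v * lookup g (u - v) else 0)"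
  proof (rule sum.cong[OF refl])
    fix v
    show "lookup (single v (lookup f v) * g) u =
      (if \<forall>i. lookup v i \<le> lookup u i then lookup f v * lookup g (u - v) else 0)"
    proof (cases "\<forall>i. lookup v i \<le> lookup u i")
      case True
      then show ?thesis
        using lookup_single_mult_add[of v "lookup f v" g "u - v"] by (simp add: lookup_le_add_diff)
    next
      case False
      then have "\<nexists>w. u = v + w" by (auto simp: lookup_add)
      then have "lookup (single v (lookup f v) * g) u = 0" by (rule lookup_single_mult_eq_0)
      then show ?thesis unfolding if_not_P[OF False] .
    qed
  qed
  finally show ?thesis .
qed

lemma mpoly_var_power:
  "(mpoly_var i :: ('n, 'k::field) mpoly) ^ k = single (single i k) 1"
  by (induction k) (simp_all add: mpoly_var_def mult_single single_add[symmetric] add.commute)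

lemma prod_mpoly_var_power:
  assumes "finite S"
  shows "(\<Prod>i\<in>S. mpoly_var i ^ k i :: ('n, 'k::field) mpoly) = single (\<Sum>i\<in>S. single i (k i)) 1"
  using assms by (induction S rule: finite_induct) (simp_all add: mpoly_var_power mult_single)

lemma lookup_sum_single:
  "finite S \<Longrightarrow> lookup (\<Sum>i\<in>S. single i (k i)) j = (if j \<in> S then k j else 0)"
  by (simp add: lookup_sum lookup_single when_def)

text \<open>The constants \<open>single 0 c\<close> embed \<open>'k\<close> injectively. This makes
  the additivity of Frobenius available in the polynomial ring.\<close>

lemma CHAR_mpoly: "CHAR(('n, 'k::field) mpoly) = CHAR('k)"
proof -
  have "(of_nat m :: ('n, 'k) mpoly) = 0 \<longleftrightarrow> (of_nat m :: 'k) = 0" for m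
    using inj_single[of "0 :: 'n \<Rightarrow>\<^sub>0 nat", THEN inj_eq, of "of_nat m" "0 :: 'k"]
    by (simp del: inj_single)
  then have "CHAR(('n, 'k) mpoly) dvd m \<longleftrightarrow> CHAR('k) dvd m" for m
    by (simp only: of_nat_eq_0_iff_char_dvd)
  then show ?thesis
    by (meson dvd_antisym dvd_refl)
qed

section \<open>Homogeneous polynomials\<close>

definition total_degree :: "('n::finite \<Rightarrow>\<^sub>0 nat) \<Rightarrow> nat"
  where "total_degree u = (\<Sum>i\<in>UNIV. lookup u i)"

lemma total_degree_add: "total_degree (u + v) = total_degree u + total_degree v"
  by (simp add: total_degree_def lookup_add sum.distrib)

lemma total_degree_single: "total_degree (single i k) = k"
  by (simp add: total_degree_def lookup_single when_def)

lemma lookup_le_total_degree: "lookup u i \<le> total_degree u"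
  unfolding total_degree_def by (rule member_le_sum) auto

definition homogeneous :: "nat \<Rightarrow> ('n::finite, 'k::zero) mpoly \<Rightarrow> bool"
  where "homogeneous d f \<longleftrightarrow> (\<forall>u\<in>keys f. total_degree u = d)"

lemma homogeneous_add: "homogeneous d f \<Longrightarrow> homogeneous d g \<Longrightarrow> homogeneous d (f + g)"
  using keys_add[of f g] by (auto simp: homogeneous_def)

lemma homogeneous_sum: "(\<And>i. i \<in> S \<Longrightarrow> homogeneous d (f i)) \<Longrightarrow> homogeneous d (\<Sum>i\<in>S. f i)"
  by (induction S rule: infinite_finite_induct) (simp_all add: homogeneous_add, simp_all add: homogeneous_def)

lemma homogeneous_mpoly_var: "homogeneous (Suc 0) (mpoly_var i)"
  by (simp add: mpoly_var_def homogeneous_def total_degree_single)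

lemma homogeneous_diff:
  fixes f g :: "('n::finite, 'k::field) mpoly"
  assumes "homogeneous d f" "homogeneous d g"
  shows "homogeneous d (f - g)"
  unfolding homogeneous_def
proof
  fix u assume "u \<in> keys (f - g)"
  then have "u \<in> keys f \<or> u \<in> keys g" by (auto simp: in_keys_iff lookup_minus)
  then show "total_degree u = d" using assms by (auto simp: homogeneous_def)
qed

lemma homogeneous_mult:
  fixes f g :: "('n::finite, 'k::field) mpoly"
  shows "homogeneous d f \<Longrightarrow> homogeneous e g \<Longrightarrow> homogeneous (d + e) (f * g)"
  using keys_mult[of f g] by (force simp: homogeneous_def total_degree_add)

lemma homogeneous_power:
  fixes f :: "('n::finite, 'k::field) mpoly"
  shows "homogeneous d f \<Longrightarrow> homogeneous (k * d) (f ^ k)"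
  by (induction k) (simp_all add: homogeneous_mult, simp_all add: homogeneous_def total_degree_def)

lemma homogeneous_prod:
  fixes f :: "'i \<Rightarrow> ('n::finite, 'k::field) mpoly"
  assumes "finite S" "\<And>i. i \<in> S \<Longrightarrow> homogeneous (d i) (f i)"
  shows "homogeneous (\<Sum>i\<in>S. d i) (\<Prod>i\<in>S. f i)"
  using assms
  by (induction S rule: finite_induct) (simp_all add: homogeneous_mult, simp_all add: homogeneous_def total_degree_def)

section \<open>Substitution\<close>

text \<open>Serves both for linear changes of coordinates and for the map sending each X_i to
  X_i^n.\<close>

definition subst :: "('n::finite \<Rightarrow> ('n, 'k::field) mpoly) \<Rightarrow> ('n, 'k) mpoly \<Rightarrow> ('n, 'k) mpoly"
  where "subst s f = (\<Sum>u\<in>keys f. single 0 (lookup f u) * (\<Prod>i\<in>UNIV. s i ^ lookup u i))"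

text \<open>Lets several polynomials share one index set, so that additivity can be checked
  termwise.\<close>

lemma subst_superset:
  assumes "finite U" "keys f \<subseteq> U"
  shows "subst s f = (\<Sum>u\<in>U. single 0 (lookup f u) * (\<Prod>i\<in>UNIV. s i ^ lookup u i))"
  unfolding subst_def using assms by (intro sum.mono_neutral_left) (auto simp: in_keys_iff)

lemma subst_single: "subst s (single u c) = single 0 c * (\<Prod>i\<in>UNIV. s i ^ lookup u i)"
  by (simp add: subst_def)

lemma subst_add: "subst s (f + g) = subst s f + subst s g"
proof -
  have "subst s h = (\<Sum>u\<in>keys f \<union> keys g \<union> keys (f + g).
      single 0 (lookup h u) * (\<Prod>i\<in>UNIV. s i ^ lookup u i))" if "h \<in> {f, g, f + g}" for h
    using that by (intro subst_superset) auto
  then show ?thesis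
    by (simp add: lookup_add single_add distrib_right sum.distrib)
qed

lemma subst_0 [simp]: "subst s 0 = 0"
  by (simp add: subst_def)

lemma subst_sum: "subst s (\<Sum>i\<in>S. f i) = (\<Sum>i\<in>S. subst s (f i))"
  by (induction S rule: infinite_finite_induct) (auto simp: subst_add)

lemma subst_single_mult:
  fixes s :: "'n::finite \<Rightarrow> ('n, 'k::field) mpoly"
  shows "subst s (single u c * single v d) = subst s (single u c) * subst s (single v d)"
proof -
  have "single 0 (c * d) = (single 0 c * single 0 d :: ('n, 'k) mpoly)" by (simp add: mult_single)
  then have *: "single 0 (c * d) * (A * B) = single 0 c * A * (single 0 d * B)" for A B :: "('n, 'k) mpoly"
    by (simp only: mult_ac)
  then show ?thesis
    by (simp add: mult_single subst_single lookup_add power_add prod.distrib *)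
qed

lemma subst_mult: "subst s (f * g) = subst s f * subst s g"
proof -
  have "f * g = (\<Sum>u\<in>keys f. \<Sum>v\<in>keys g. single u (lookup f u) * single v (lookup g v))"
    by (subst poly_mapping_eq_sum_single[of f], subst poly_mapping_eq_sum_single[of g]) (rule sum_product)
  then have "subst s (f * g) = (\<Sum>u\<in>keys f. \<Sum>v\<in>keys g. subst s (single u (lookup f u)) * subst s (single v (lookup g v)))"
    by (simp only: subst_sum subst_single_mult)
  also have "\<dots> = (\<Sum>u\<in>keys f. subst s (single u (lookup f u))) * (\<Sum>v\<in>keys g. subst s (single v (lookup g v)))"
    by (rule sum_product[symmetric])
  also have "\<dots> = subst s f * subst s g"
    by (simp only: subst_sum[symmetric] poly_mapping_eq_sum_single[symmetric])
  finally show ?thesis .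
qed

lemma subst_const: "subst s (single 0 c) = single 0 c"
  by (simp add: subst_single)

lemma subst_1: "subst s 1 = 1"
  using subst_const[of s 1] by simp

lemma subst_power: "subst s (f ^ k) = subst s f ^ k"
  by (induction k) (auto simp: subst_1 subst_mult)

lemma subst_prod: "subst s (\<Prod>i\<in>S. f i) = (\<Prod>i\<in>S. subst s (f i))"
  by (induction S rule: infinite_finite_induct) (auto simp: subst_1 subst_mult)

lemma subst_diff: "subst s (f - g) = subst s f - subst s g"
  using subst_add[of s "f - g" g] by simp

lemma subst_mpoly_var [simp]: "subst s (mpoly_var i) = s i"
proof -
  have "(\<Prod>j\<in>UNIV. s j ^ lookup (single i 1) j) = (\<Prod>j\<in>UNIV. if j = i then s i else 1)"
    by (rule prod.cong) (auto simp: lookup_single when_def)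
  then show ?thesis by (simp add: mpoly_var_def subst_single)
qed

lemma subst_subst: "subst t (subst s f) = subst (\<lambda>i. subst t (s i)) f"
  unfolding subst_def[of s f] subst_sum
  by (simp add: subst_mult subst_const subst_prod subst_power subst_def[of "\<lambda>i. subst t (s i)" f])

lemma subst_ident: "subst mpoly_var f = f"
proof -
  have *: "(\<Sum>i\<in>UNIV. single i (lookup u i)) = u" for u :: "'a \<Rightarrow>\<^sub>0 nat"
    by (rule poly_mapping_eqI) (simp add: lookup_sum_single)
  have "subst mpoly_var f = (\<Sum>u\<in>keys f. single u (lookup f u))"
    unfolding subst_def by (simp add: prod_mpoly_var_power mult_single *)
  then show ?thesis by (simp add: poly_mapping_eq_sum_single[symmetric])
qed

lemma homogeneous_subst:
  assumes "\<And>i. homogeneous 1 (s i)" "homogeneous d f"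
  shows "homogeneous d (subst s f)"
  unfolding subst_def
proof (rule homogeneous_sum)
  fix u assume "u \<in> keys f"
  then have "total_degree u = d" using assms(2) by (simp add: homogeneous_def)
  moreover have "homogeneous (lookup u i) (s i ^ lookup u i)" for i
    using homogeneous_power[OF assms(1), of "lookup u i" i] by simp
  then have "homogeneous (total_degree u) (\<Prod>i\<in>UNIV. s i ^ lookup u i)"
    unfolding total_degree_def by (intro homogeneous_prod) auto
  moreover have "homogeneous 0 (single 0 (lookup f u))"
    by (simp add: homogeneous_def total_degree_def)
  ultimately show "homogeneous d (single 0 (lookup f u) * (\<Prod>i\<in>UNIV. s i ^ lookup u i))"
    using homogeneous_mult[of 0 "single 0 (lookup f u)" "total_degree u" "\<Prod>i\<in>UNIV. s i ^ lookup u i"] by simp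
qed

section \<open>Binomial coefficients modulo a prime\<close>

text \<open>In Vandermonde's convolution for \<open>p + N\<close>, only the coefficients of (1 +
  X)^p at 0 and \<open>p\<close> survive modulo \<open>p\<close>.\<close>

lemma choose_add_prime_cong:
  fixes p :: nat
  assumes "prime p"
  shows "[(p + N) choose k = (N choose k) + (if p \<le> k then N choose (k - p) else 0)] (mod p)"
proof -
  define f where "f i = (p choose i) * (N choose (k - i))" for i
  have z: "[f i = 0] (mod p)" if "i \<noteq> 0" "i \<noteq> p" for i
  proof (cases "i < p")
    case True
    then show ?thesis
      using dvd_choose_prime[of i p] assms that by (simp add: f_def cong_0_iff)
  qed (use that in \<open>simp add: f_def binomial_eq_0\<close>)
  have p: "p > 0" using assms by (rule prime_gt_0_nat)
  have "(p + N) choose k = (\<Sum>i\<le>k. f i)"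
    by (simp add: vandermonde f_def)
  also have "\<dots> = f 0 + (\<Sum>i\<in>{..k} - {0}. f i)"
    by (subst sum.remove[of _ 0]) auto
  also have "[\<dots> = f 0 + (\<Sum>i\<in>{..k} - {0}. if i = p then f p else 0)] (mod p)"
    by (intro cong_add cong_sum cong_refl) (use z in auto)
  also have "f 0 + (\<Sum>i\<in>{..k} - {0}. if i = p then f p else 0)
      = (N choose k) + (if p \<le> k then N choose (k - p) else 0)"
    using p by (simp add: f_def)
  finally show ?thesis .
qed

text \<open>One digit of Lucas' theorem. Raising \<open>N\<close> by one adds \<open>p\<close> to
  the upper argument, so the preceding congruence becomes Pascal's rule for the leading
  parts.\<close>

lemma lucas_cong:
  fixes p :: nat
  assumes "prime p" "r < p" "s < p"
  shows "[(p * N + r) choose (p * k + s) = (N choose k) * (r choose s)] (mod p)"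
proof (induction N arbitrary: k)
  case 0
  show ?case using assms by (cases k) (auto simp: binomial_eq_0)
next
  case (Suc N)
  have *: "[(p + (p * N + r)) choose (p * k + s) = ((p * N + r) choose (p * k + s)) +
      (if p \<le> p * k + s then (p * N + r) choose (p * k + s - p) else 0)] (mod p)"
    by (rule choose_add_prime_cong[OF assms(1)])
  show ?case
  proof (cases k)
    case 0
    then show ?thesis
      using * Suc.IH[of 0] assms by (auto simp: add.assoc intro: cong_trans)
  next
    case (Suc l)
    have "[(p * N + r choose (p * k + s)) + (p * N + r choose (p * l + s)) =
       (N choose k) * (r choose s) + (N choose l) * (r choose s)] (mod p)"
      by (intro cong_add Suc.IH)
    with * show ?thesis
      unfolding Suc by (auto simp: algebra_simps intro: cong_trans)
  qed
qed

text \<open>The binomial coefficient divides n!, all of whose factors are below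
  \<open>p\<close>.\<close>

lemma prime_not_dvd_choose:
  fixes p :: nat
  assumes "prime p" "n < p" "k \<le> n"
  shows "\<not> p dvd (n choose k)"
  using assms choose_dvd[of k n] binomial_fact_lemma[of k n]
  by (metis dvd_mult leD prime_dvd_fact_iff)

text \<open>A borrow in the last base-\<open>p\<close> digit makes the last factor in Lucas'
  congruence zero.\<close>

lemma prime_dvd_choose_if_mod_less:
  fixes p :: nat
  assumes "prime p" "N mod p < k mod p"
  shows "p dvd (N choose k)"
proof -
  have "p > 0" using assms(1) by (rule prime_gt_0_nat)
  then have "[(p * (N div p) + N mod p) choose (p * (k div p) + k mod p)
      = (N div p choose (k div p)) * (N mod p choose (k mod p))] (mod p)"
    by (intro lucas_cong assms(1)) auto
  then show ?thesis using assms(2) by (simp add: cong_0_iff binomial_eq_0)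
qed

text \<open>The product is the multinomial coefficient ((n-1)m)! / m!^(n-1). If no factor is
  divisible by \<open>p\<close>, adding \<open>m\<close> repeatedly never carries out of the last
  digit \<open>d\<close>; this forces n d = p - 1.\<close>

lemma prime_dvd_multinomial:
  fixes p n m e :: nat
  assumes p: "prime p" and q: "p ^ e = n * m + 1" and n: "n \<ge> 1" and m: "m > 0"
    and ndvd: "\<not> [p = 1] (mod n)"
  shows "p dvd (\<Prod>j\<in>{1..n-1}. (j * m) choose m)"
proof (rule ccontr)
  assume nd: "\<not> p dvd (\<Prod>j\<in>{1..n-1}. (j * m) choose m)"
  define d where "d = m mod p"
  have p1: "p > 1" using p by (rule prime_gt_1_nat)
  have d: "d < p" using p1 by (simp add: d_def)
  have e: "e > 0" using q m n by (cases e) auto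
  have c: "d \<le> (j * m) mod p" if "j \<in> {1..n-1}" for j
  proof (rule ccontr)
    assume "\<not> d \<le> (j * m) mod p"
    then have "p dvd ((j * m) choose m)"
      using p by (intro prime_dvd_choose_if_mod_less) (auto simp: d_def)
    then have "p dvd (\<Prod>j\<in>{1..n-1}. (j * m) choose m)"
      using that by (intro dvd_prodI[THEN dvd_trans[rotated]]) auto
    with nd show False by blast
  qed
  \<comment> \<open>After a carry the new last digit would be j d + d - p, which is less than
    \<open>d\<close>.\<close>
  have step: "(j + 1) * d < p \<and> ((j + 1) * m) mod p = (j + 1) * d"
    if "j * d < p" "(j * m) mod p = j * d" "d \<le> ((j + 1) * m) mod p" for j
  proof -
    have eq: "((j + 1) * m) mod p = (j * d + d) mod p"
      using that(2) by (metis add.commute add_mult_distrib d_def mod_add_eq mult_1)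
    have "j * d + d < p"
    proof (rule ccontr)
      assume *: "\<not> j * d + d < p"
      then have "(j * d + d) mod p = j * d + d - p"
        using that(1) d by (simp add: mod_if)
      then show False using that(1,3) eq d * by linarith
    qed
    then show ?thesis using eq by simp
  qed
  have a: "j * d < p \<and> (j * m) mod p = j * d" if "j \<le> n - 1" for j
    using that
  proof (induction j)
    case (Suc j)
    then show ?case using step[of j] c[of "Suc j"] by simp
  qed (use p1 in auto)
  have nm: "(n * m) mod p = p - 1"
  proof -
    have "n * m = p ^ e - 1" using q by simp
    moreover have "p ^ e = p * p ^ (e - 1)" using e by (simp add: power_eq_if)
    ultimately have "n * m = p * (p ^ (e - 1) - 1) + (p - 1)"
      using p1 mult_le_mono2[of 1 "p ^ (e - 1)" p] by (simp add: diff_mult_distrib2)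
    then show ?thesis using p1 by (simp only: mod_mult_self4) simp
  qed
  \<comment> \<open>The bound \<open>c\<close> stops at n - 1. For the last step, n m = p^e - 1 has
    the largest possible last digit, p - 1.\<close>
  have "n * d < p \<and> (n * m) mod p = n * d"
    using step[of "n - 1"] a[of "n - 1"] nm n d by simp
  then have "p = n * d + 1" using nm p1 by linarith
  then have "[p = 1] (mod n)" by (simp only: cong_def mod_mult_self4)
  with ndvd show False by blast
qed

text \<open>Passing from \<open>e\<close> to e + 1 appends the digit \<open>d\<close> to
  \<open>m\<close>. Multiplication by j <= n causes no carry, since n d = p - 1, so Lucas'
  congruence splits off a factor prime to \<open>p\<close>.\<close>

lemma prime_not_dvd_choose_multiple:
  fixes p n m e :: nat
  assumes p: "prime p" and n: "p = n * d + 1" and j: "j \<in> {1..n}" and q: "p ^ e = n * m + 1"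
  shows "\<not> p dvd ((j * m) choose m)"
  using q
proof (induction e arbitrary: m)
  case 0
  have "p > 1" using p by (rule prime_gt_1_nat)
  then show ?case using 0 j by auto
next
  case (Suc e)
  have "n > 0" using j by auto
  have "[p ^ e = 1 ^ e] (mod n)" using n by (intro cong_pow) (simp add: cong_def mod_Suc)
  then have "n dvd p ^ e - 1"
    using p prime_gt_0_nat[OF p] by (subst cong_altdef_nat[symmetric]) auto
  then obtain m' where "p ^ e - 1 = n * m'" by blast
  then have m': "p ^ e = n * m' + 1"
    using prime_gt_0_nat[OF p] by (metis Suc_eq_plus1 Suc_pred' zero_less_power)
  have "n * m = p * (n * m' + 1) - 1" using Suc.prems m' by simp
  also have "\<dots> = n * (p * m' + d)" using n by (simp add: algebra_simps)
  finally have m: "m = p * m' + d" using \<open>n > 0\<close> by simp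
  have jd: "j * d < p" using j n by (simp add: le_imp_less_Suc)
  moreover have dj: "d \<le> j * d" using j by simp
  moreover have "d < p" using dj jd by (rule le_less_trans)
  ultimately have "[(p * (j * m') + j * d) choose (p * m' + d) = ((j * m') choose m') * (j * d choose d)] (mod p)"
    using p by (intro lucas_cong) auto
  moreover have "(p * (j * m') + j * d) = j * m" by (simp add: m algebra_simps)
  ultimately have "[(j * m) choose m = ((j * m') choose m') * (j * d choose d)] (mod p)"
    by (simp add: m)
  moreover have "\<not> p dvd (j * m' choose m')" by (rule Suc.IH[OF m'])
  moreover have "\<not> p dvd (j * d choose d)"
    using p jd dj by (intro prime_not_dvd_choose) auto
  ultimately show ?case
    using p by (metis cong_dvd_iff prime_dvd_mult_iff)
qed

section \<open>Powers of sums of variables\<close>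

definition free_of :: "'n \<Rightarrow> ('n, 'k::zero) mpoly \<Rightarrow> bool"
  where "free_of j f \<longleftrightarrow> (\<forall>u\<in>keys f. lookup u j = 0)"

lemma free_of_mult:
  fixes f g :: "('n, 'k::field) mpoly"
  shows "free_of j f \<Longrightarrow> free_of j g \<Longrightarrow> free_of j (f * g)"
  using keys_mult[of f g] by (force simp: free_of_def lookup_add)

lemma free_of_power:
  fixes f :: "('n, 'k::field) mpoly"
  shows "free_of j f \<Longrightarrow> free_of j (f ^ k)"
  by (induction k) (simp_all add: free_of_mult, simp_all add: free_of_def)

lemma free_of_prod:
  fixes f :: "'i \<Rightarrow> ('n, 'k::field) mpoly"
  shows "(\<And>i. i \<in> S \<Longrightarrow> free_of j (f i)) \<Longrightarrow> free_of j (\<Prod>i\<in>S. f i)"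
  by (induction S rule: infinite_finite_induct) (simp_all add: free_of_mult, simp_all add: free_of_def)

lemma free_of_sum:
  fixes f :: "'i \<Rightarrow> ('n, 'k::field) mpoly"
  shows "(\<And>i. i \<in> S \<Longrightarrow> free_of j (f i)) \<Longrightarrow> free_of j (\<Sum>i\<in>S. f i)"
proof (induction S rule: infinite_finite_induct)
  case (insert x S)
  then show ?case
    using keys_add[of "f x" "sum f S"] by (auto simp: free_of_def)
qed (simp_all add: free_of_def)

lemma free_of_mpoly_var: "i \<noteq> j \<Longrightarrow> free_of j (mpoly_var i)"
  by (simp add: free_of_def mpoly_var_def lookup_single when_def)

text \<open>The value is the multinomial coefficient, built up by splitting off one variable at a
  time with the binomial theorem. The case \<open>d = 1\<close> serves the linear form,
  \<open>d = n\<close> the Fermat polynomial.\<close>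

lemma lookup_power_sum_mpoly_var:
  assumes "finite S" "d > 0"
  shows "lookup ((\<Sum>i\<in>S. mpoly_var i ^ d) ^ (card S * m) :: ('n, 'k::field) mpoly) (\<Sum>i\<in>S. single i (d * m))
    = of_nat (\<Prod>j\<in>{1..card S}. (j * m) choose m)"
  using assms(1)
proof (induction S rule: finite_induct)
  case empty
  show ?case by simp
next
  case (insert s S)
  define G where "G = (\<Sum>i\<in>S. mpoly_var i ^ d :: ('n, 'k) mpoly)"
  define w where "w = (\<Sum>i\<in>S. single i (d * m))"
  define N where "N = Suc (card S) * m"
  have ws: "lookup w s = 0"
    using insert by (simp add: w_def lookup_sum_single)
  have G: "free_of s (G ^ k)" for k
    unfolding G_def using insert by (intro free_of_power free_of_sum free_of_mpoly_var) auto
  \<comment> \<open>\<open>G\<close> does not involve X_s, so the exponent of X_s in the target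
    monomial determines \<open>l\<close>.\<close>
  have term_l: "lookup (single (single s (d * l)) c * G ^ (N - l)) (single s (d * m) + w) =
      (if l = m then c * lookup (G ^ (N - l)) w else 0)" for l and c :: 'k
  proof (cases l m rule: linorder_cases)
    case less
    define v where "v = single s (d * (m - l)) + w"
    have "single s (d * m) + w = single s (d * l) + v"
      using less by (simp add: v_def single_add[symmetric] add.assoc[symmetric] distrib_left[symmetric])
    moreover have "lookup v s \<noteq> 0"
      using less assms(2) by (simp add: v_def lookup_add)
    then have "v \<notin> keys (G ^ (N - l))"
      using G[of "N - l"] by (auto simp: free_of_def)
    then have "lookup (G ^ (N - l)) v = 0" by (simp add: in_keys_iff)
    ultimately show ?thesis using less by (simp add: lookup_single_mult_add)
  next
    case equal
    then show ?thesis by (simp add: lookup_single_mult_add)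
  next
    case greater
    have "\<nexists>v. single s (d * m) + w = single s (d * l) + v"
    proof
      assume "\<exists>v. single s (d * m) + w = single s (d * l) + v"
      then obtain v where "single s (d * m) + w = single s (d * l) + v" by blast
      then have "d * m = d * l + lookup v s"
        by (metis add.right_neutral lookup_add lookup_single_eq ws)
      then have "d * l \<le> d * m" by simp
      with greater assms(2) show False by simp
    qed
    then show ?thesis using greater by (simp add: lookup_single_mult_eq_0)
  qed
  have var_power: "(mpoly_var s ^ d) ^ l = (single (single s (d * l)) 1 :: ('n, 'k) mpoly)" for l
    by (metis mpoly_var_power power_mult)
  have "(mpoly_var s ^ d + G) ^ N =
      (\<Sum>l\<le>N. of_nat (N choose l) * (mpoly_var s ^ d) ^ l * G ^ (N - l))"
    by (rule binomial_ring)
  also have "\<dots> = (\<Sum>l\<le>N. single (single s (d * l)) (of_nat (N choose l)) * G ^ (N - l))"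
    by (simp add: var_power mult_single single_of_nat[symmetric] del: single_of_nat)
  finally have "lookup ((mpoly_var s ^ d + G) ^ N) (single s (d * m) + w) =
      (\<Sum>l\<le>N. if l = m then of_nat (N choose l) * lookup (G ^ (N - l)) w else 0)"
    by (simp add: lookup_sum term_l)
  also have "\<dots> = of_nat (N choose m) * lookup (G ^ (card S * m)) w"
    by (simp add: N_def)
  also have "\<dots> = of_nat (\<Prod>j\<in>{1..Suc (card S)}. (j * m) choose m)"
    using insert.IH by (simp add: G_def w_def N_def mult.commute)
  finally show ?case
    using insert.hyps by (simp add: G_def w_def N_def)
qed

section \<open>Monomial ideals\<close>

text \<open>The ideal generated by the X_i^m with i in \<open>S\<close>. Being monomial, it is
  described through supports.\<close>

definition power_ideal :: "'n set \<Rightarrow> nat \<Rightarrow> ('n, 'k::field) mpoly set"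
  where "power_ideal S m = {f. \<forall>u\<in>keys f. \<exists>i\<in>S. m \<le> lookup u i}"

lemma power_ideal_0: "0 \<in> power_ideal S m"
  by (simp add: power_ideal_def)

lemma power_ideal_add: "f \<in> power_ideal S m \<Longrightarrow> g \<in> power_ideal S m \<Longrightarrow> f + g \<in> power_ideal S m"
  using keys_add[of f g] by (auto simp: power_ideal_def)

lemma power_ideal_mult: "f \<in> power_ideal S m \<Longrightarrow> g * f \<in> power_ideal S m"
  using keys_mult[of g f] by (fastforce simp: power_ideal_def lookup_add intro: trans_le_add2)

lemma power_ideal_sum:
  "(\<And>i. i \<in> T \<Longrightarrow> f i \<in> power_ideal S m) \<Longrightarrow> (\<Sum>i\<in>T. f i) \<in> power_ideal S m"
  by (induction T rule: infinite_finite_induct) (auto simp: power_ideal_0 power_ideal_add)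

lemma mpoly_var_power_in_power_ideal:
  "i \<in> S \<Longrightarrow> m \<le> k \<Longrightarrow> mpoly_var i ^ k \<in> power_ideal S m"
  by (auto simp: mpoly_var_power power_ideal_def intro!: bexI[of _ i])

lemma subst_in_power_ideal:
  fixes f :: "('n::finite, 'k::field) mpoly"
  assumes "\<And>i. i \<in> S \<Longrightarrow> s i ^ m \<in> power_ideal T l" "f \<in> power_ideal S m"
  shows "subst s f \<in> power_ideal T l"
  unfolding subst_def
proof (rule power_ideal_sum)
  fix u assume "u \<in> keys f"
  then obtain i where i: "i \<in> S" "m \<le> lookup u i"
    using assms(2) by (auto simp: power_ideal_def)
  have "(\<Prod>j\<in>UNIV. s j ^ lookup u j) = s i ^ lookup u i * (\<Prod>j\<in>UNIV - {i}. s j ^ lookup u j)"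
    by (rule prod.remove) auto
  also have "s i ^ lookup u i = s i ^ (lookup u i - m) * s i ^ m"
    using i(2) by (simp add: power_add[symmetric])
  finally have "single 0 (lookup f u) * (\<Prod>j\<in>UNIV. s j ^ lookup u j) =
      (single 0 (lookup f u) * (\<Prod>j\<in>UNIV - {i}. s j ^ lookup u j) * s i ^ (lookup u i - m)) * s i ^ m"
    by (simp add: mult_ac)
  then show "single 0 (lookup f u) * (\<Prod>j\<in>UNIV. s j ^ lookup u j) \<in> power_ideal T l"
    using power_ideal_mult[OF assms(1)[OF i(1)]] by simp
qed

lemma single_dvd_iff:
  fixes f :: "('n, 'k::field) mpoly"
  shows "single v 1 dvd f \<longleftrightarrow> (\<forall>u\<in>keys f. \<forall>i. lookup v i \<le> lookup u i)"
proof
  assume "single v 1 dvd f"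
  then obtain g where "f = single v 1 * g" by blast
  then show "\<forall>u\<in>keys f. \<forall>i. lookup v i \<le> lookup u i"
    using keys_mult[of "single v 1" g] by (force simp: lookup_add)
next
  assume *: "\<forall>u\<in>keys f. \<forall>i. lookup v i \<le> lookup u i"
  have "f = (\<Sum>u\<in>keys f. single u (lookup f u))"
    by (rule poly_mapping_eq_sum_single)
  also have "\<dots> = (\<Sum>u\<in>keys f. single v 1 * single (u - v) (lookup f u))"
    by (rule sum.cong) (use * in \<open>simp_all add: mult_single lookup_le_add_diff\<close>)
  also have "\<dots> = single v 1 * (\<Sum>u\<in>keys f. single (u - v) (lookup f u))"
    by (simp add: sum_distrib_left)
  finally show "single v 1 dvd f" by (rule dvdI)
qed

lemma mpoly_var_power_dvd_iff:
  fixes f :: "('n, 'k::field) mpoly"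
  shows "mpoly_var i ^ m dvd f \<longleftrightarrow> (\<forall>u\<in>keys f. m \<le> lookup u i)"
  by (auto simp: mpoly_var_power single_dvd_iff lookup_single when_def)

section \<open>The colon ideal of a power of a linear form\<close>

text \<open>
  The linear change of coordinates exchanging \<open>X\<^sub>j\<close> and the linear form preserves the ideal
  generated by the \<open>q\<close>-th powers of the variables, which reduces the claim to the monomial case.
\<close>

lemma linear_form_power_dvd:
  fixes h :: "('n::finite, 'k::field) mpoly"
  assumes p: "prime CHAR('k)" and q: "q = CHAR('k) ^ e" and b: "b \<le> q"
    and S: "j \<in> S" and h: "homogeneous d h" "d < q"
    and L: "(\<Sum>i\<in>S. mpoly_var i) ^ b * h \<in> power_ideal S q"
  shows "(\<Sum>i\<in>S. mpoly_var i) ^ (q - b) dvd h"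
proof -
  have pc: "prime CHAR(('n, 'k) mpoly)" and qc: "q = CHAR(('n, 'k) mpoly) ^ e"
    using p q by (simp_all add: CHAR_mpoly)
  define L where "L = (\<Sum>i\<in>S. mpoly_var i :: ('n, 'k) mpoly)"
  define M where "M = (\<Sum>i\<in>S - {j}. mpoly_var i :: ('n, 'k) mpoly)"
  have LM: "L = mpoly_var j + M"
    unfolding L_def M_def by (rule sum.remove) (use S in auto)
  \<comment> \<open>\<open>s\<close> turns \<open>L\<close> into X_j, and \<open>t\<close> undoes
    this.\<close>
  define s where "s i = (if i = j then mpoly_var j - M else mpoly_var i)" for i
  define t where "t i = (if i = j then L else mpoly_var i)" for i
  have sM: "subst s M = M" and tM: "subst t M = M"
    unfolding M_def subst_sum by (auto simp: s_def t_def intro!: sum.cong)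
  have sL: "subst s L = mpoly_var j"
    by (simp add: LM subst_add sM) (simp add: s_def)
  have ts: "subst t (subst s f) = f" for f
  proof -
    have "subst t (s i) = mpoly_var i" for i
      by (auto simp: s_def subst_diff tM) (auto simp: t_def LM)
    then show ?thesis by (simp add: subst_subst subst_ident)
  qed
  have "homogeneous 1 (s i)" for i
    by (auto simp: s_def M_def intro!: homogeneous_diff homogeneous_sum homogeneous_mpoly_var)
  then have hom: "homogeneous d (subst s h)"
    using h by (intro homogeneous_subst) auto
  \<comment> \<open>Frobenius is additive, so (X_j - M)^q is a combination of q-th powers of
    variables in \<open>S\<close>.\<close>
  have sq: "s i ^ q \<in> power_ideal S q" if "i \<in> S" for i
  proof (cases "i = j")
    case True
    have "(mpoly_var j - M) ^ q = (mpoly_var j + (\<Sum>i\<in>S - {j}. - mpoly_var i)) ^ q"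
      by (simp add: M_def sum_negf)
    also have "\<dots> = mpoly_var j ^ q + (\<Sum>i\<in>S - {j}. (- mpoly_var i) ^ q)"
      by (simp only: freshmans_dream'[OF pc qc] freshmans_dream_sum'[OF pc qc])
    also have "(\<Sum>i\<in>S - {j}. (- mpoly_var i) ^ q) = (\<Sum>i\<in>S - {j}. (- 1) ^ q * mpoly_var i ^ q)"
      by (intro sum.cong refl power_minus)
    finally show ?thesis
      using True S by (auto simp: s_def intro!: power_ideal_add power_ideal_sum power_ideal_mult mpoly_var_power_in_power_ideal)
  next
    case False
    then show ?thesis using that by (simp add: s_def mpoly_var_power_in_power_ideal)
  qed
  have "subst s (L ^ b * h) \<in> power_ideal S q"
    using L sq by (intro subst_in_power_ideal) (auto simp: L_def)
  then have *: "single (single j b) 1 * subst s h \<in> power_ideal S q"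
    by (simp add: subst_mult subst_power sL mpoly_var_power)
  \<comment> \<open>Since \<open>u\<close> has total degree below \<open>q\<close>, only the
    exponent of X_j, raised by \<open>b\<close>, can reach \<open>q\<close>.\<close>
  have "q - b \<le> lookup u j" if u: "u \<in> keys (subst s h)" for u
  proof -
    have "single j b + u \<in> keys (single (single j b) 1 * subst s h)"
      using u by (simp add: in_keys_iff lookup_single_mult_add)
    then obtain i where i: "i \<in> S" "q \<le> lookup (single j b + u) i"
      using * by (auto simp: power_ideal_def)
    have "lookup u i \<le> d"
      using hom u lookup_le_total_degree[of u i] by (auto simp: homogeneous_def)
    with i(2) h(2) show ?thesis
      by (cases "i = j") (auto simp: lookup_add lookup_single when_def)
  qed
  then have "mpoly_var j ^ (q - b) dvd subst s h"
    by (simp add: mpoly_var_power_dvd_iff)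
  then obtain g where "subst s h = mpoly_var j ^ (q - b) * g" by blast
  then have "subst t (subst s h) = L ^ (q - b) * subst t g"
    by (simp add: subst_mult subst_power) (simp add: t_def)
  then show ?thesis by (simp add: ts L_def)
qed

text \<open>The linear form also contains X_j, so the prime X_i does not divide it and X_i^m can be
  cancelled against it.\<close>

lemma mpoly_var_power_dvd_linear_form_mult:
  fixes g :: "('n::finite, 'k::field) mpoly"
  assumes ij: "i \<in> S" "j \<in> S" "i \<noteq> j" and dvd: "mpoly_var i ^ m dvd (\<Sum>l\<in>S. mpoly_var l) * g"
  shows "mpoly_var i ^ m dvd g"
proof (rule ccontr)
  assume "\<not> mpoly_var i ^ m dvd g"
  then have ex: "\<exists>u\<in>keys g. lookup u i < m"
    by (auto simp: mpoly_var_power_dvd_iff not_le)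
  \<comment> \<open>Among the monomials of \<open>g\<close> with least exponent of \<open>X\<^sub>i\<close>, one with largest exponent of \<open>X\<^sub>j\<close>
    cannot be cancelled after multiplication by \<open>X\<^sub>j\<close>.\<close>
  define k where "k = Min ((\<lambda>u. lookup u i) ` keys g)"
  have k_le: "k \<le> lookup u i" if "u \<in> keys g" for u
    unfolding k_def using that by (intro Min_le) auto
  have "k < m" using ex k_le by force
  define U where "U = {u \<in> keys g. lookup u i = k}"
  have "k \<in> (\<lambda>u. lookup u i) ` keys g"
    unfolding k_def using ex by (intro Min_in) auto
  then have U: "finite U" "U \<noteq> {}" by (auto simp: U_def)
  define l where "l = Max ((\<lambda>u. lookup u j) ` U)"
  have l_ge: "lookup u j \<le> l" if "u \<in> U" for u
    unfolding l_def using that U by (intro Max_ge) auto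
  have "l \<in> (\<lambda>u. lookup u j) ` U"
    unfolding l_def using U by (intro Max_in) auto
  then obtain u where u: "u \<in> U" "lookup u j = l" by auto
  define v where "v = single j 1 + u"
  have "lookup (mpoly_var r * g) v = (if r = j then lookup g u else 0)" for r
  proof (cases "r = j")
    case True
    then show ?thesis by (simp add: v_def mpoly_var_def lookup_single_mult_add)
  next
    case False
    have "lookup (mpoly_var r * g) v = 0"
    proof (cases "\<exists>w. v = single r 1 + w")
      case True
      then obtain w where w: "v = single r 1 + w" by blast
      \<comment> \<open>A cancelling term \<open>w\<close> of \<open>g\<close> would have minimal
        exponent of X_i but an exponent of X_j above the maximum \<open>l\<close>.\<close>
      have wj: "lookup w j = l + 1"
        using arg_cong[OF w, of "\<lambda>x. lookup x j"] False u(2)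
        by (simp add: v_def lookup_add lookup_single when_def)
      have wi: "lookup w i \<le> k"
        using arg_cong[OF w, of "\<lambda>x. lookup x i"] ij u(1)
        by (auto simp: v_def lookup_add lookup_single when_def U_def split: if_splits)
      have "w \<notin> keys g"
      proof
        assume "w \<in> keys g"
        then have "w \<in> U" using wi k_le[of w] by (simp add: U_def)
        then show False using l_ge[of w] wj by simp
      qed
      then show ?thesis
        unfolding w mpoly_var_def by (simp add: lookup_single_mult_add in_keys_iff)
    qed (auto simp: mpoly_var_def intro: lookup_single_mult_eq_0)
    then show ?thesis using False by simp
  qed
  then have "lookup ((\<Sum>l\<in>S. mpoly_var l) * g) v = lookup g u"
    using ij by (simp add: sum_distrib_right lookup_sum)
  then have "v \<in> keys ((\<Sum>l\<in>S. mpoly_var l) * g)"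
    using u by (auto simp: U_def in_keys_iff)
  then have "m \<le> lookup v i"
    using dvd by (simp add: mpoly_var_power_dvd_iff)
  then show False
    using u(1) ij \<open>k < m\<close> by (simp add: v_def U_def lookup_add lookup_single when_def)
qed

lemma mpoly_var_power_dvd_linear_form_power_mult:
  fixes g :: "('n::finite, 'k::field) mpoly"
  assumes "i \<in> S" "j \<in> S" "i \<noteq> j" "mpoly_var i ^ m dvd (\<Sum>l\<in>S. mpoly_var l) ^ k * g"
  shows "mpoly_var i ^ m dvd g"
  using assms(4)
proof (induction k)
  case (Suc k)
  have "mpoly_var i ^ m dvd (\<Sum>l\<in>S. mpoly_var l) ^ k * g"
    using Suc.prems unfolding power_Suc mult.assoc
    by (rule mpoly_var_power_dvd_linear_form_mult[OF assms(1-3)])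
  then show ?case by (rule Suc.IH)
qed simp

section \<open>The membership criterion\<close>

lemma ideal_mpoly_ring_closed:
  assumes "ideal J (mpoly_ring :: ('n, 'k::field) mpoly ring)"
  shows "0 \<in> J" "f \<in> J \<Longrightarrow> g \<in> J \<Longrightarrow> f + g \<in> J" "f \<in> J \<Longrightarrow> g * f \<in> J"
proof -
  interpret ideal J "mpoly_ring :: ('n, 'k) mpoly ring" by (rule assms)
  show "0 \<in> J" using additive_subgroup.zero_closed[OF is_additive_subgroup] by (simp add: zero_class)
  show "f + g \<in> J" if "f \<in> J" "g \<in> J"
    using additive_subgroup.a_closed[OF is_additive_subgroup that] by (simp add: plus_class)
  show "g * f \<in> J" if "f \<in> J"
    using I_l_closed[OF that, of g] by (simp add: class_simps)
qed

text \<open>Adjoining \<open>f\<close> to a basis of the subspace \<open>J\<close> keeps it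
  independent, so the value 1 at \<open>f\<close> and 0 on the basis extends linearly.\<close>

lemma separating_functional:
  fixes f :: "('n, 'k::field) mpoly"
  assumes J: "ideal J (mpoly_ring :: ('n, 'k) mpoly ring)" and f: "f \<notin> J"
  obtains \<phi> :: "('n, 'k) mpoly \<Rightarrow> 'k"
  where "\<And>g h. \<phi> (g + h) = \<phi> g + \<phi> h" "\<And>c g. \<phi> (single 0 c * g) = c * \<phi> g"
    "\<And>g. g \<in> J \<Longrightarrow> \<phi> g = 0" "\<phi> f = 1"
proof -
  let ?s = "\<lambda>c (g :: ('n, 'k) mpoly). single 0 c * g"
  interpret P: vector_space ?s
    by unfold_locales (simp_all add: algebra_simps single_add mult_single mult.assoc[symmetric])
  interpret K: vector_space "(*) :: 'k \<Rightarrow> 'k \<Rightarrow> 'k"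
    by unfold_locales (simp_all add: algebra_simps)
  interpret PK: vector_space_pair ?s "(*) :: 'k \<Rightarrow> 'k \<Rightarrow> 'k" ..
  have "P.subspace J"
    by (rule P.subspaceI) (auto intro: ideal_mpoly_ring_closed[OF J])
  obtain B where B: "B \<subseteq> J" "P.independent B" "J \<subseteq> P.span B"
    using P.maximal_independent_subset by blast
  have "f \<notin> P.span B"
    using P.span_minimal[OF B(1) \<open>P.subspace J\<close>] f by blast
  then have "P.independent (insert f B)"
    using B(2) by (rule P.independent_insertI)
  from PK.linear_independent_extend[OF this, of "\<lambda>x. if x = f then 1 else 0"]
  obtain \<phi> where lin: "Vector_Spaces.linear ?s ((*) :: 'k \<Rightarrow> 'k \<Rightarrow> 'k) \<phi>"
    and \<phi>: "\<forall>x\<in>insert f B. \<phi> x = (if x = f then 1 else 0)"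
    by blast
  interpret lin: Vector_Spaces.linear ?s "(*) :: 'k \<Rightarrow> 'k \<Rightarrow> 'k" \<phi> by (rule lin)
  have "\<phi> g = 0" if "g \<in> J" for g
  proof -
    have "g \<in> P.span B" using B(3) that by blast
    then show ?thesis
    proof (rule P.span_induct[of g B "\<lambda>g. \<phi> g = 0"], goal_cases)
      case 1
      show ?case by (rule P.subspaceI) (auto simp: lin.add lin.scale lin.zero)
    next
      case (2 x)
      then show ?case using \<phi> f B(1) by auto
    qed
  qed
  moreover have "\<phi> f = 1"
    using bspec[OF \<phi>, of f] by simp
  ultimately show thesis
    by (rule that[OF lin.add lin.scale])
qed

lemma finite_bounded_exponents:
  "finite {u :: 'n::finite \<Rightarrow>\<^sub>0 nat. \<forall>i. lookup u i \<le> N i}"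
proof (rule finite_imageD)
  have "lookup ` {u :: 'n \<Rightarrow>\<^sub>0 nat. \<forall>i. lookup u i \<le> N i} \<subseteq> PiE UNIV (\<lambda>i. {..N i})"
    by auto
  then show "finite (lookup ` {u :: 'n \<Rightarrow>\<^sub>0 nat. \<forall>i. lookup u i \<le> N i})"
    by (rule finite_subset) (auto intro: finite_PiE)
  show "inj_on lookup {u :: 'n \<Rightarrow>\<^sub>0 nat. \<forall>i. lookup u i \<le> N i}"
    by (rule inj_onI) (simp only: poly_mapping_eq_iff)
qed

text \<open>Macaulay duality in the variables of \<open>S\<close>: the socle degree (n-1)(q-1) minus
  the degree n(n-2)m of the monomial expression is q - 1, the degree of the dual form. Quantifying
  over all \<open>J\<close> containing the generators expresses membership in the ideal they
  generate.\<close>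

lemma linear_form_monomial_mem_ideal:
  fixes J :: "('n::finite, 'k::field) mpoly set"
  defines "n \<equiv> CARD('n)" and "p \<equiv> CHAR('k)"
  assumes n: "n \<ge> 3" and p: "prime p" and q: "p ^ e = n * m + 1"
    and dvd: "p dvd (\<Prod>j\<in>{1..n-1}. (j * m) choose m)"
    and J: "ideal J mpoly_ring"
    and S: "S = UNIV - {i0}" and L: "L = (\<Sum>i\<in>S. mpoly_var i)" and b: "b = (n - 1) * m + 1"
    and XJ: "\<And>i. i \<in> S \<Longrightarrow> mpoly_var i ^ b \<in> J" and LJ: "L ^ b \<in> J"
  shows "(\<Prod>i\<in>S. mpoly_var i) ^ ((n - 2) * m) * L ^ ((n - 2) * m) \<in> J"
proof (rule ccontr)
  define q where "q = n * m + 1"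
  define a where "a = (n - 2) * m"
  define P where "P = (\<Prod>i\<in>S. mpoly_var i) ^ a * L ^ a"
  obtain n' where n': "n = n' + 3" using n by (metis add.commute le_Suc_ex)
  have bq: "q = b + m" "b \<le> q" and ab: "a + m + 1 = b"
    by (simp_all add: q_def b a_def n' algebra_simps)
  have S': "finite S" "card S = n - 1" and iS: "i \<in> S \<longleftrightarrow> i \<noteq> i0" for i
    by (simp_all add: S card_Diff_subset n_def)
  assume "(\<Prod>i\<in>S. mpoly_var i) ^ ((n - 2) * m) * L ^ ((n - 2) * m) \<notin> J"
  then have "P \<notin> J" by (simp add: P_def a_def)
  then obtain \<phi> :: "('n, 'k) mpoly \<Rightarrow> 'k"
    where \<phi>: "\<And>g h. \<phi> (g + h) = \<phi> g + \<phi> h" "\<And>c g. \<phi> (single 0 c * g) = c * \<phi> g"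
      "\<And>g. g \<in> J \<Longrightarrow> \<phi> g = 0" "\<phi> P = 1"
    using separating_functional[OF J] by metis
  have \<phi>_sum: "\<phi> (\<Sum>v\<in>V. F v) = (\<Sum>v\<in>V. \<phi> (F v))" for V and F :: "('n \<Rightarrow>\<^sub>0 nat) \<Rightarrow> ('n, 'k) mpoly"
    using \<phi>(2)[of 0 0] by (induction V rule: infinite_finite_induct) (simp_all add: \<phi>(1))
  have \<phi>_0: "\<phi> (single v 1) = 0" if i: "i \<in> S" "b \<le> lookup v i" for v i
  proof -
    have "single i b + (v - single i b) = v"
      using i by (intro lookup_le_add_diff) (auto simp: lookup_single when_def)
    then have "single v 1 = single (v - single i b) 1 * (mpoly_var i ^ b :: ('n, 'k) mpoly)"
      by (simp add: mpoly_var_power mult_single add.commute)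
    then show ?thesis
      using \<phi>(3) ideal_mpoly_ring_closed(3)[OF J XJ[OF i(1)]] by simp
  qed
  have \<phi>_shift: "\<phi> (single w 1 * f) = (\<Sum>v\<in>keys f. lookup f v * \<phi> (single (w + v) 1))" for w f
  proof -
    have "single w 1 * f = single w 1 * (\<Sum>v\<in>keys f. single v (lookup f v))"
      by (simp add: poly_mapping_eq_sum_single[symmetric])
    also have "\<dots> = (\<Sum>v\<in>keys f. single 0 (lookup f v) * single (w + v) 1)"
      by (simp add: sum_distrib_left mult_single)
    finally show ?thesis by (simp only: \<phi>_sum \<phi>(2))
  qed

  define top where "top = (\<Sum>i\<in>S. single i (q - 1))"
  have top: "lookup top i = (if i \<in> S then q - 1 else 0)" for i
    using S' by (simp add: top_def lookup_sum_single)
  \<comment> \<open>The divisors of the socle monomial; the variable \<open>i0\<close> is excluded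
    since its exponent in \<open>top\<close> is 0.\<close>
  define B where "B = {u. (\<forall>i. lookup u i \<le> lookup top i)}"
  have finB: "finite {u \<in> B. total_degree u = q - 1}"
    using finite_bounded_exponents[of "lookup top"] by (simp add: B_def)
  \<comment> \<open>The Macaulay dual of \<open>\<phi>\<close> in degree \<open>n a\<close>: on forms of that degree not involving the variable
    \<open>i0\<close>, \<open>\<phi> f\<close> is the coefficient of the socle monomial \<open>top\<close> in \<open>f h\<close>.\<close>
  define h where "h = (\<Sum>u\<in>{u \<in> B. total_degree u = q - 1}. single u (\<phi> (single (top - u) 1)))"
  have lookup_h: "lookup h u = (if u \<in> B \<and> total_degree u = q - 1 then \<phi> (single (top - u) 1) else 0)" for u
    using finB by (simp add: h_def lookup_sum lookup_single when_def)
  have hom_h: "homogeneous (q - 1) h" and free_h: "free_of i0 h"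
    by (auto simp: homogeneous_def free_of_def in_keys_iff lookup_h B_def top iS split: if_splits)

  \<comment> \<open>A term \<open>v\<close> of \<open>f\<close> not dividing \<open>u\<close> gives
    \<open>top - u + v\<close> an exponent of at least \<open>q\<close>, where \<open>\<phi>\<close>
    vanishes. Hence the convolution may run over all terms of \<open>f\<close>.\<close>
  have lookup_mult_h: "lookup (f * h) u = (if total_degree u = d + (q - 1) then \<phi> (single (top - u) 1 * f) else 0)"
    if f: "homogeneous d f" "free_of i0 f" and u: "u \<in> B" for f d u
  proof -
    have "lookup (f * h) u =
        (\<Sum>v\<in>keys f. if \<forall>i. lookup v i \<le> lookup u i then lookup f v * lookup h (u - v) else 0)"
      by (rule lookup_mult_sum_keys)
    also have "\<dots> = (\<Sum>v\<in>keys f. if total_degree u = d + (q - 1)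
        then lookup f v * \<phi> (single (top - u + v) 1) else 0)"
    proof (rule sum.cong[OF refl])
      fix v assume v: "v \<in> keys f"
      show "(if \<forall>i. lookup v i \<le> lookup u i then lookup f v * lookup h (u - v) else 0) =
        (if total_degree u = d + (q - 1) then lookup f v * \<phi> (single (top - u + v) 1) else 0)"
      proof (cases "\<forall>i. lookup v i \<le> lookup u i")
        case True
        have "total_degree v + total_degree (u - v) = total_degree u"
          using True by (simp add: total_degree_add[symmetric] lookup_le_add_diff)
        then have "total_degree (u - v) = q - 1 \<longleftrightarrow> total_degree u = d + (q - 1)"
          using f(1) v by (auto simp: homogeneous_def)
        moreover have "u - v \<in> B"
          using u by (auto simp: B_def lookup_minus intro: le_trans[OF diff_le_self])
        moreover have "top - (u - v) = top - u + v"
          using True u by (intro poly_mapping_eqI) (auto simp: B_def lookup_minus lookup_add)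
        ultimately show ?thesis using True by (simp add: lookup_h)
      next
        case False
        then obtain i where i: "lookup u i < lookup v i" by (auto simp: not_le)
        then have "i \<in> S"
          using f(2) v unfolding iS free_of_def by (metis not_less_zero)
        moreover have "b \<le> lookup (top - u + v) i"
          using i bq \<open>i \<in> S\<close> by (simp add: lookup_add lookup_minus top)
        ultimately have "\<phi> (single (top - u + v) 1) = 0" by (rule \<phi>_0)
        then show ?thesis unfolding if_not_P[OF False] by simp
      qed
    qed
    finally show ?thesis by (simp add: \<phi>_shift)
  qed

  have hom_L: "homogeneous k (L ^ k)" and free_L: "free_of i0 (L ^ k)" for k
    using homogeneous_power[of 1 L k]
    by (auto simp: L S intro!: homogeneous_sum homogeneous_mpoly_var free_of_power free_of_sum free_of_mpoly_var)
  \<comment> \<open>All multiples of \<open>L ^ b\<close> are killed by \<open>\<phi>\<close>, so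
    the product has no coefficient inside \<open>B\<close>.\<close>
  have "L ^ b * h \<in> power_ideal S q"
    unfolding power_ideal_def
  proof safe
    fix u assume u: "u \<in> keys (L ^ b * h)"
    show "\<exists>i\<in>S. q \<le> lookup u i"
    proof (rule ccontr)
      assume "\<not> (\<exists>i\<in>S. q \<le> lookup u i)"
      moreover have "lookup u i0 = 0"
        using free_of_mult[OF free_L free_h] u by (auto simp: free_of_def)
      ultimately have "u \<in> B"
        by (auto simp: B_def top iS not_le q_def less_Suc_eq_le)
      then have "lookup (L ^ b * h) u = 0"
        by (simp add: lookup_mult_h[OF hom_L free_L] \<phi>(3)[OF ideal_mpoly_ring_closed(3)[OF J LJ]])
      then show False using u by (simp add: in_keys_iff)
    qed
  qed
  moreover obtain j where "j \<in> S" using S' n by fastforce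
  ultimately have "(\<Sum>i\<in>S. mpoly_var i) ^ (q - b) dvd h"
    using p q bq by (intro linear_form_power_dvd[where j = j and d = "q - 1" and e = e] hom_h) (simp_all add: L p_def q_def)
  then have "L ^ m dvd h" by (simp add: L bq)
  then obtain g where g: "h = L ^ m * g" by blast
  \<comment> \<open>If \<open>v\<close> has exponent below \<open>m\<close> at \<open>i\<close>,
    then \<open>top - v\<close> has exponent at least q - m = b there, where \<open>\<phi>\<close>
    vanishes. So X_i^m divides \<open>h\<close>, and L^m can be cancelled because \<open>S\<close>
    has a second element.\<close>
  have g_ge: "m \<le> lookup u i" if "i \<in> S" "u \<in> keys g" for i u
  proof -
    have "m \<le> lookup v i" if v: "v \<in> keys h" for v
    proof (rule ccontr)
      assume "\<not> m \<le> lookup v i"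
      then have "b \<le> lookup (top - v) i"
        using \<open>i \<in> S\<close> bq by (simp add: lookup_minus top)
      then have "\<phi> (single (top - v) 1) = 0"
        using \<open>i \<in> S\<close> by (intro \<phi>_0)
      then show False using v by (auto simp: in_keys_iff lookup_h split: if_splits)
    qed
    then have "mpoly_var i ^ m dvd h"
      by (simp add: mpoly_var_power_dvd_iff)
    moreover have "card (S - {i}) > 0"
      using S' that n by (simp add: card_Diff_subset)
    then obtain j where "j \<in> S" "j \<noteq> i" by (auto simp: card_gt_0_iff)
    ultimately have "mpoly_var i ^ m dvd (\<Sum>l\<in>S. mpoly_var l) ^ m * g"
      by (simp add: g L)
    with \<open>i \<in> S\<close> \<open>j \<in> S\<close> \<open>j \<noteq> i\<close>[symmetric] have "mpoly_var i ^ m dvd g"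
      by (rule mpoly_var_power_dvd_linear_form_power_mult)
    then show ?thesis
      using that by (simp add: mpoly_var_power_dvd_iff)
  qed

  define mm where "mm = (\<Sum>i\<in>S. single i m)"
  have mm: "lookup mm i = (if i \<in> S then m else 0)" for i
    using S' by (simp add: mm_def lookup_sum_single)
  have total: "total_degree (\<Sum>i\<in>S. single i k) = (n - 1) * k" for k :: nat
    using S' by (simp add: total_degree_def lookup_sum_single sum.If_cases)
  have am: "a + m = (n - 1) * m"
    by (simp add: a_def n' algebra_simps)
  \<comment> \<open>Terms of \<open>g\<close> already use exponent \<open>m\<close> in every
    variable of \<open>S\<close>. By degree, the cofactor from L^(a+m) must then be
    \<open>mm\<close>, whose coefficient is the vanishing multinomial coefficient.\<close>
  have "lookup (L ^ (a + m) * g) (mm + mm) = 0"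
    unfolding lookup_mult_sum_keys
  proof (rule sum.neutral, safe)
    fix v assume v: "v \<in> keys (L ^ (a + m))"
    show "(if \<forall>i. lookup v i \<le> lookup (mm + mm) i
        then lookup (L ^ (a + m)) v * lookup g (mm + mm - v) else 0) = 0"
    proof (cases "(\<forall>i. lookup v i \<le> lookup (mm + mm) i) \<and> mm + mm - v \<in> keys g")
      case True
      have v_le: "lookup v i \<le> lookup mm i" for i
      proof (cases "i \<in> S")
        case i: True
        then have "m \<le> lookup (mm + mm - v) i" using g_ge True by blast
        then show ?thesis
          using i True by (auto simp: mm lookup_minus lookup_add dest: spec[of _ i])
      next
        case False
        have "lookup v i \<le> lookup (mm + mm) i" using True by blast
        with False show ?thesis by (simp add: lookup_add mm)
      qed
      have "total_degree v = total_degree mm"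
        using v hom_L[of "a + m"] total[of m] by (simp add: homogeneous_def mm_def am)
      then have "total_degree (mm - v) = 0"
        using total_degree_add[of v "mm - v"] lookup_le_add_diff[of v mm] v_le by simp
      then have "lookup (mm - v) i = 0" for i
        by (simp add: total_degree_def)
      then have "v = mm"
        using v_le by (intro poly_mapping_eqI) (simp add: lookup_minus le_antisym)
      moreover have "lookup (L ^ (a + m)) mm = 0"
        using lookup_power_sum_mpoly_var[of S 1 m, where 'k = 'k] S' dvd
        by (simp add: L mm_def am p_def of_nat_eq_0_iff_char_dvd del: of_nat_prod)
      ultimately show ?thesis by simp
    qed (auto simp: in_keys_iff)
  qed
  moreover have "P * h = single (\<Sum>i\<in>S. single i a) 1 * (L ^ (a + m) * g)"
    using S' prod_mpoly_var_power[of S "\<lambda>_. a", where 'k = 'k]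
    by (simp add: P_def g power_add prod_power_distrib mult_ac)
  moreover have "top = (\<Sum>i\<in>S. single i a) + (mm + mm)"
  proof (rule poly_mapping_eqI)
    have "q - 1 = a + (m + m)" using ab bq by simp
    then show "lookup top i = lookup ((\<Sum>i\<in>S. single i a) + (mm + mm)) i" for i
      using S' by (simp add: top mm lookup_add lookup_sum_single)
  qed
  ultimately have "lookup (P * h) top = 0"
    by (simp add: lookup_single_mult_add)
  moreover have "homogeneous ((n - 1) * a + a) P" "free_of i0 P"
  proof -
    have "homogeneous (\<Sum>i\<in>S. Suc 0) (\<Prod>i\<in>S. mpoly_var i :: ('n, 'k) mpoly)"
      using S'(1) by (rule homogeneous_prod) (rule homogeneous_mpoly_var)
    then have "homogeneous ((n - 1) * a) ((\<Prod>i\<in>S. mpoly_var i :: ('n, 'k) mpoly) ^ a)"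
      using homogeneous_power[of "\<Sum>i\<in>S. Suc 0" _ a] S' by (simp add: mult.commute)
    then show "homogeneous ((n - 1) * a + a) P"
      unfolding P_def by (intro homogeneous_mult hom_L)
    show "free_of i0 P"
      unfolding P_def by (intro free_of_mult free_L free_of_power free_of_prod free_of_mpoly_var) (simp add: iS)
  qed
  moreover have "top \<in> B" by (simp add: B_def)
  moreover have "total_degree top = (n - 1) * a + a + (q - 1)"
    unfolding top_def total by (simp add: a_def q_def n' algebra_simps)
  \<comment> \<open>At \<open>u = top\<close> the shift \<open>top - u\<close> is zero, so the
    coefficient is \<open>\<phi> P\<close> itself.\<close>
  ultimately have "\<phi> P = 0"
    by (simp add: lookup_mult_h)
  with \<phi>(4) show False by simp
qed

section \<open>Passing to the Fermat ring\<close>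

lemma ideal_mpoly_ringI:
  fixes J :: "('n, 'k::field) mpoly set"
  assumes "0 \<in> J" "\<And>f g. f \<in> J \<Longrightarrow> g \<in> J \<Longrightarrow> f + g \<in> J" "\<And>f g. f \<in> J \<Longrightarrow> g * f \<in> J"
  shows "ideal J mpoly_ring"
proof (rule idealI)
  show "ring (mpoly_ring :: ('n, 'k) mpoly ring)" by (rule cring_class.ring_axioms)
  show "subgroup J (add_monoid mpoly_ring)"
  proof (rule group.subgroupI[OF abelian_group.a_group[OF ring.is_abelian_group[OF cring_class.ring_axioms]]])
    show "J \<noteq> {}" using assms(1) by blast
    show "inv\<^bsub>add_monoid mpoly_ring\<^esub> f \<in> J" if "f \<in> J" for f
    proof -
      have "inv\<^bsub>add_monoid mpoly_ring\<^esub> f = \<ominus>\<^bsub>mpoly_ring\<^esub> f"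
        by (simp only: a_inv_def)
      then show ?thesis using assms(3)[OF that, of "- 1"] by (simp add: uminus_class)
    qed
  qed (use assms(2) in \<open>simp_all add: cring_class_ops_def\<close>)
qed (use assms(3) in \<open>simp_all add: class_simps mult.commute\<close>)

lemma fermat_ideal_subset_iff:
  assumes J: "ideal J mpoly_ring"
  shows "fermat_ideal \<subseteq> J \<longleftrightarrow> fermat_poly \<in> J"
proof
  have "fermat_poly \<in> fermat_ideal"
    unfolding fermat_ideal_def by (rule ring.genideal_self'[OF cring_class.ring_axioms]) (simp add: carrier_class)
  then show "fermat_ideal \<subseteq> J \<Longrightarrow> fermat_poly \<in> J" by blast
  show "fermat_poly \<in> J \<Longrightarrow> fermat_ideal \<subseteq> J"
    unfolding fermat_ideal_def by (rule ring.genideal_minimal[OF cring_class.ring_axioms J]) simp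
qed

section \<open>Pulling ideal membership in the Fermat ring back to polynomials\<close>

context
  fixes \<pi> :: "('n::finite, 'k::field) mpoly \<Rightarrow> ('n, 'k) mpoly set"
    and R :: "('n, 'k) mpoly set ring"
  defines "\<pi> \<equiv> \<lambda>f. fermat_ideal +>\<^bsub>mpoly_ring\<^esub> f"
  defines "R \<equiv> fermat_ring"
begin

interpretation R: cring R
  unfolding R_def by (rule cring_fermat_ring)

interpretation I: ideal "fermat_ideal :: ('n, 'k) mpoly set" mpoly_ring
  by (rule ideal_fermat_ideal)

lemma rcos_hom: "\<pi> \<in> ring_hom mpoly_ring R"
  unfolding \<pi>_def R_def fermat_ring_def by (rule I.rcos_ring_hom)

lemma rcos_closed: "\<pi> f \<in> carrier R"
  using ring_hom_closed[OF rcos_hom] by (simp add: carrier_class)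

lemma rcos_add: "\<pi> (f + g) = \<pi> f \<oplus>\<^bsub>R\<^esub> \<pi> g"
  using ring_hom_add[OF rcos_hom, of f g] by (simp add: class_simps)

lemma rcos_mult: "\<pi> (f * g) = \<pi> f \<otimes>\<^bsub>R\<^esub> \<pi> g"
  using ring_hom_mult[OF rcos_hom, of f g] by (simp add: class_simps)

lemma rcos_one: "\<pi> 1 = \<one>\<^bsub>R\<^esub>"
  using ring_hom_one[OF rcos_hom] by (simp add: class_simps)

lemma rcos_zero: "\<pi> 0 = \<zero>\<^bsub>R\<^esub>"
  using ring_hom_zero[OF rcos_hom cring_class.ring_axioms R.ring_axioms] by (simp add: class_simps)

lemma rcos_power: "\<pi> (f ^ k) = \<pi> f [^]\<^bsub>R\<^esub> k"
  by (induction k) (simp_all add: rcos_one rcos_mult R.m_comm rcos_closed)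

lemma rcos_prod:
  assumes "finite S"
  shows "\<pi> (\<Prod>i\<in>S. f i) = (\<Otimes>\<^bsub>R\<^esub>i\<in>S. \<pi> (f i))"
  using assms by (induction S rule: finite_induct) (simp_all add: rcos_one rcos_mult rcos_closed)

lemma rcos_eq_iff: "\<pi> f = \<pi> g \<longleftrightarrow> f - g \<in> fermat_ideal"
  using ring.quotient_eq_iff_same_a_r_cos[OF cring_class.ring_axioms ideal_fermat_ideal, of f g]
  by (simp add: \<pi>_def class_simps)

text \<open>The image of such a \<open>J\<close> is an ideal containing the generators; conversely,
  the preimage of the generated ideal is itself such a \<open>J\<close>.\<close>

lemma rcos_mem_genideal_iff:
  "\<pi> f \<in> Idl\<^bsub>R\<^esub> (\<pi> ` B) \<longleftrightarrow>
    (\<forall>J. ideal J mpoly_ring \<longrightarrow> fermat_poly \<in> J \<longrightarrow> B \<subseteq> J \<longrightarrow> f \<in> J)"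
proof safe
  fix J :: "('n, 'k) mpoly set"
  assume f: "\<pi> f \<in> Idl\<^bsub>R\<^esub> (\<pi> ` B)" and J: "ideal J mpoly_ring" "fermat_poly \<in> J" "B \<subseteq> J"
  have "ideal (\<pi> ` J) R"
    using ring.ring_ideal_imp_quot_ideal[OF cring_class.ring_axioms ideal_fermat_ideal J(1)]
    by (simp add: \<pi>_def R_def fermat_ring_def)
  then have "Idl\<^bsub>R\<^esub> (\<pi> ` B) \<subseteq> \<pi> ` J"
    using J(3) by (intro R.genideal_minimal) auto
  with f obtain g where g: "g \<in> J" "\<pi> f = \<pi> g" by auto
  then have "f - g \<in> J"
    using fermat_ideal_subset_iff[OF J(1)] J(2) rcos_eq_iff[of f g] by blast
  then show "f \<in> J"
    using ideal_mpoly_ring_closed(2)[OF J(1) _ g(1), of "f - g"] by simp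
next
  assume *: "\<forall>J. ideal J mpoly_ring \<longrightarrow> fermat_poly \<in> J \<longrightarrow> B \<subseteq> J \<longrightarrow> f \<in> J"
  have B: "\<pi> ` B \<subseteq> carrier R" by (auto simp: rcos_closed)
  interpret G: ideal "Idl\<^bsub>R\<^esub> (\<pi> ` B)" R
    by (rule R.genideal_ideal[OF B])
  define J where "J = {f. \<pi> f \<in> Idl\<^bsub>R\<^esub> (\<pi> ` B)}"
  have "ideal J mpoly_ring"
    by (rule ideal_mpoly_ringI)
      (auto simp: J_def rcos_add rcos_mult rcos_zero rcos_closed intro: G.I_l_closed)
  moreover have "fermat_poly - 0 \<in> fermat_ideal"
    using fermat_ideal_subset_iff[OF ideal_fermat_ideal] by simp
  then have "\<pi> fermat_poly = \<zero>\<^bsub>R\<^esub>"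
    using rcos_eq_iff[of fermat_poly 0] rcos_zero by metis
  then have "fermat_poly \<in> J" by (simp add: J_def)
  moreover have "B \<subseteq> J"
    using R.genideal_self[OF B] by (auto simp: J_def)
  ultimately have "f \<in> J" using * by blast
  then show "\<pi> f \<in> Idl\<^bsub>R\<^esub> (\<pi> ` B)" by (simp add: J_def)
qed

text \<open>Independence of the generating set reduces Frobenius closure to the given generators,
  and the preceding criterion removes the quotient.\<close>

lemma fermat_frobenius_closure_iff:
  assumes "prime CHAR('k)"
  shows "(\<Otimes>\<^bsub>R\<^esub>i\<in>UNIV. fermat_var i) [^]\<^bsub>R\<^esub> l
      \<in> frobenius_closure R CHAR('k) (Idl\<^bsub>R\<^esub> ((\<lambda>i. fermat_var i [^]\<^bsub>R\<^esub> k) ` UNIV)) \<longleftrightarrow>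
    (\<exists>e. \<forall>J :: ('n, 'k) mpoly set. ideal J mpoly_ring \<longrightarrow> fermat_poly \<in> J \<longrightarrow>
      (\<forall>i. mpoly_var i ^ (k * CHAR('k) ^ e) \<in> J) \<longrightarrow> (\<Prod>i\<in>UNIV. mpoly_var i) ^ (l * CHAR('k) ^ e) \<in> J)"
proof -
  define p where "p = CHAR('k)"
  have var: "fermat_var i = \<pi> (mpoly_var i)" for i
    by (simp add: fermat_var_def \<pi>_def)
  have *: "(\<Otimes>\<^bsub>R\<^esub>i\<in>UNIV. fermat_var i) [^]\<^bsub>R\<^esub> l = \<pi> ((\<Prod>i\<in>UNIV. mpoly_var i) ^ l)"
    by (simp add: var rcos_power rcos_prod)
  have "(\<lambda>a. a [^]\<^bsub>R\<^esub> p ^ e) ` (\<lambda>i. fermat_var i [^]\<^bsub>R\<^esub> k) ` UNIV =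
      \<pi> ` (\<lambda>i. mpoly_var i ^ (k * p ^ e)) ` UNIV" for e
    by (auto simp: var power_mult rcos_power image_image)
  then have "frobenius_power R (p ^ e) ((\<lambda>i. fermat_var i [^]\<^bsub>R\<^esub> k) ` UNIV) =
      Idl\<^bsub>R\<^esub> (\<pi> ` (\<lambda>i. mpoly_var i ^ (k * p ^ e)) ` UNIV)" for e
    by (simp add: frobenius_power_def)
  moreover have "(\<lambda>i. fermat_var i [^]\<^bsub>R\<^esub> k) ` UNIV \<subseteq> carrier R"
    by (auto simp: var rcos_closed)
  moreover have "[p] \<cdot>\<^bsub>R\<^esub> \<one>\<^bsub>R\<^esub> = \<zero>\<^bsub>R\<^esub>"
    unfolding R_def p_def by (rule fermat_ring_char)
  ultimately have "\<pi> ((\<Prod>i\<in>UNIV. mpoly_var i) ^ l)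
      \<in> frobenius_closure R p (Idl\<^bsub>R\<^esub> ((\<lambda>i. fermat_var i [^]\<^bsub>R\<^esub> k) ` UNIV)) \<longleftrightarrow>
    (\<exists>e. \<pi> ((\<Prod>i\<in>UNIV. mpoly_var i) ^ l) [^]\<^bsub>R\<^esub> (p ^ e) \<in> Idl\<^bsub>R\<^esub> (\<pi> ` (\<lambda>i. mpoly_var i ^ (k * p ^ e)) ` UNIV))"
    using assms by (subst R.mem_frobenius_closure_Idl_iff) (simp_all add: p_def rcos_closed)
  then show ?thesis
    unfolding * p_def rcos_power[symmetric] power_mult[symmetric] rcos_mem_genideal_iff
    by (simp add: image_subset_iff)
qed

end

text \<open>The witness is the colon ideal of the X_i^((n-1)q) by F^(q-1). The product monomial
  escapes it because a multinomial coefficient is nonzero modulo \<open>p\<close>.\<close>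

lemma prod_mpoly_var_notin_ideal:
  fixes n p :: nat
  defines "n \<equiv> CARD('n)" and "p \<equiv> CHAR('k)"
  assumes n: "n \<ge> 2" and p: "prime p" and d: "p = n * d + 1"
  obtains J :: "('n::finite, 'k::field) mpoly set"
  where "ideal J mpoly_ring" "fermat_poly \<in> J" "\<And>i. mpoly_var i ^ ((n - 1) * p ^ e) \<in> J"
    "(\<Prod>i\<in>UNIV. mpoly_var i) ^ ((n - 2) * p ^ e) \<notin> J"
proof -
  let ?F = "fermat_poly :: ('n, 'k) mpoly"
  define q where "q = p ^ e"
  have "[p ^ e = 1 ^ e] (mod n)"
    by (intro cong_pow) (simp only: d cong_def mod_mult_self4)
  then have "n dvd q - 1"
    using prime_gt_0_nat[OF p] by (subst cong_altdef_nat[symmetric]) (auto simp: q_def)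
  then obtain m where "q - 1 = n * m" by blast
  then have m: "q = n * m + 1"
    using prime_gt_0_nat[OF p] by (metis Suc_eq_plus1 Suc_pred' q_def zero_less_power)
  \<comment> \<open>\<open>F\<close> lies in \<open>J\<close> because \<open>F^(q-1) F = F^q\<close> is the sum of the \<open>X\<^sub>i^(n q)\<close>.\<close>
  define J where "J = {f. ?F ^ (q - 1) * f \<in> power_ideal UNIV ((n - 1) * q)}"
  have pc: "prime CHAR(('n, 'k) mpoly)" and qc: "q = CHAR(('n, 'k) mpoly) ^ e"
    using p by (simp_all add: CHAR_mpoly q_def p_def)
  have F: "?F = (\<Sum>i\<in>UNIV. mpoly_var i ^ n)"
    by (simp add: fermat_poly_def n_def)
  have "ideal J mpoly_ring"
  proof (rule ideal_mpoly_ringI)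
    fix f g assume "f \<in> J"
    then have "g * (?F ^ (q - 1) * f) \<in> power_ideal UNIV ((n - 1) * q)"
      unfolding J_def mem_Collect_eq by (rule power_ideal_mult)
    then show "g * f \<in> J" by (simp add: J_def mult_ac)
  qed (simp_all add: J_def power_ideal_0 distrib_left power_ideal_add)
  moreover have "?F \<in> J"
  proof -
    have "?F ^ (q - 1) * ?F = ?F ^ q"
      using m by simp
    also have "\<dots> = (\<Sum>i\<in>UNIV. mpoly_var i ^ (n * q))"
      unfolding F freshmans_dream_sum'[OF pc qc] by (simp only: power_mult)
    also have "\<dots> \<in> power_ideal UNIV ((n - 1) * q)"
      by (intro power_ideal_sum mpoly_var_power_in_power_ideal) simp_all
    finally show ?thesis by (simp add: J_def)
  qed
  moreover have "mpoly_var i ^ ((n - 1) * p ^ e) \<in> J" for i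
    unfolding J_def mem_Collect_eq
    by (intro power_ideal_mult mpoly_var_power_in_power_ideal) (simp_all add: q_def)
  moreover have "(\<Prod>i\<in>UNIV. mpoly_var i) ^ ((n - 2) * p ^ e) \<notin> J"
  proof
    assume "(\<Prod>i\<in>UNIV. mpoly_var i) ^ ((n - 2) * p ^ e) \<in> J"
    then have *: "single (\<Sum>i\<in>UNIV. single i ((n - 2) * q)) 1 * ?F ^ (q - 1) \<in> power_ideal UNIV ((n - 1) * q)"
      using prod_mpoly_var_power[of UNIV "\<lambda>_ :: 'n. (n - 2) * q", where 'k = 'k]
      by (simp add: J_def q_def prod_power_distrib mult.commute)
    \<comment> \<open>Each exponent is (n-2)q + (q-1) = (n-1)q - 1, just below the bound of the
      monomial ideal.\<close>
    define u where "u = (\<Sum>i\<in>UNIV. single i ((n - 2) * q)) + (\<Sum>i\<in>UNIV. single (i :: 'n) (n * m))"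
    have "lookup (?F ^ (q - 1)) (\<Sum>i\<in>UNIV. single i (n * m)) = of_nat (\<Prod>j\<in>{1..n}. (j * m) choose m)"
      using lookup_power_sum_mpoly_var[of "UNIV :: 'n set" n m, where 'k = 'k] n m
      by (simp add: F n_def[symmetric] del: of_nat_prod)
    moreover have "\<not> p dvd (\<Prod>j\<in>{1..n}. (j * m) choose m)"
      using prime_not_dvd_choose_multiple[OF p d, of _ e m] p m
      by (auto simp: prime_dvd_prod_iff q_def)
    ultimately have "u \<in> keys (single (\<Sum>i\<in>UNIV. single i ((n - 2) * q)) 1 * ?F ^ (q - 1))"
      by (simp add: u_def in_keys_iff lookup_single_mult_add p_def of_nat_eq_0_iff_char_dvd del: of_nat_prod)
    then obtain i where "(n - 1) * q \<le> lookup u i"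
      using * by (auto simp: power_ideal_def)
    moreover have "lookup u i = (n - 2) * q + n * m"
      by (simp add: u_def lookup_add lookup_sum_single)
    moreover have "(n - 1) * q = (n - 2) * q + q"
      using n by (simp add: algebra_simps flip: add_mult_distrib)
    ultimately show False using m by simp
  qed
  ultimately show thesis by (rule that)
qed

text \<open>Pulling \<open>J\<close> back along X_i -> X_i^n turns \<open>L\<close> into -X_i0^n
  modulo the Fermat polynomial, so the duality lemma applies to the pullback.\<close>

lemma prod_mpoly_var_mem_ideal:
  fixes J :: "('n::finite, 'k::field) mpoly set"
  defines "n \<equiv> CARD('n)" and "p \<equiv> CHAR('k)"
  assumes n: "n \<ge> 3" and p: "prime p" and q: "p ^ e = n * m + 1" and m: "m > 0"
    and ncong: "\<not> [p = 1] (mod n)"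
    and J: "ideal J mpoly_ring" and F: "fermat_poly \<in> J"
    and X: "\<And>i. mpoly_var i ^ ((n - 1) * p ^ e) \<in> J"
  shows "(\<Prod>i\<in>UNIV. mpoly_var i) ^ ((n - 2) * p ^ e) \<in> J"
proof -
  note closed = ideal_mpoly_ring_closed[OF J]
  obtain n' where n': "n = n' + 3" using n by (metis add.commute le_Suc_ex)
  \<comment> \<open>An arbitrary choice of the variable to be eliminated.\<close>
  define i0 :: 'n where "i0 = undefined"
  define S where "S = UNIV - {i0}"
  define L where "L = (\<Sum>i\<in>S. mpoly_var i :: ('n, 'k) mpoly)"
  define s where "s i = (mpoly_var i ^ n :: ('n, 'k) mpoly)" for i :: 'n
  define a where "a = (n - 2) * m"
  define b where "b = (n - 1) * m + 1"
  have up: "mpoly_var i ^ k \<in> J" if "(n - 1) * p ^ e \<le> k" for i k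
    using closed(3)[OF X[of i], of "mpoly_var i ^ (k - (n - 1) * p ^ e)"] that
    by (simp add: power_add[symmetric])
  \<comment> \<open>In fact n b = (n-1) p^e + 1.\<close>
  have nb: "(n - 1) * p ^ e \<le> n * b"
    unfolding q by (simp add: n' b_def algebra_simps)
  have F_eq: "subst s L = fermat_poly + (- 1) * mpoly_var i0 ^ n"
  proof -
    have "(fermat_poly :: ('n, 'k) mpoly) = mpoly_var i0 ^ n + (\<Sum>i\<in>S. mpoly_var i ^ n)"
      unfolding fermat_poly_def n_def S_def by (rule sum.remove) auto
    then show ?thesis by (simp add: L_def subst_sum s_def eq_diff_eq add.commute)
  qed
  \<comment> \<open>The difference of the two k-th powers is a multiple of
    \<open>fermat_poly\<close>, which lies in \<open>J\<close>.\<close>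
  have mod_F: "(fermat_poly + z) ^ k * g \<in> J \<longleftrightarrow> z ^ k * g \<in> J" for z g k
  proof -
    obtain c where c: "(fermat_poly + z) ^ k - z ^ k = fermat_poly * c"
      using power_diff_sumr2[of "fermat_poly + z" k z] by (simp only: add_diff_cancel_right')
    have c': "(fermat_poly + z) ^ k = z ^ k + fermat_poly * c"
      using c by (simp add: diff_eq_eq add.commute)
    have "fermat_poly * c * g \<in> J" "- 1 * (fermat_poly * c * g) \<in> J"
      using closed(3)[OF F, of "c * g"] closed(3)[OF F, of "- 1 * (c * g)"] by (simp_all add: mult_ac)
    moreover have "(fermat_poly + z) ^ k * g = z ^ k * g + fermat_poly * c * g"
      by (simp add: c' algebra_simps)
    moreover have "z ^ k * g = (fermat_poly + z) ^ k * g + - 1 * (fermat_poly * c * g)"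
      by (simp add: c' algebra_simps)
    ultimately show ?thesis
      using closed(2)[of "z ^ k * g" "fermat_poly * c * g"]
        closed(2)[of "(fermat_poly + z) ^ k * g" "- 1 * (fermat_poly * c * g)"] by auto
  qed
  define J' where "J' = {f. subst s f \<in> J}"
  have J': "ideal J' mpoly_ring"
    by (rule ideal_mpoly_ringI) (auto simp: J'_def subst_add subst_mult closed)
  have XJ': "mpoly_var i ^ b \<in> J'" if "i \<in> S" for i
    using up[OF nb, of i] by (simp add: J'_def subst_power s_def power_mult)
  have LJ': "L ^ b \<in> J'"
  proof -
    have "(- 1 * mpoly_var i0 ^ n) ^ b * 1 \<in> J"
      using closed(3)[OF up[OF nb], of "(- 1) ^ b" i0] by (simp only: power_mult_distrib power_mult mult_1_right)
    then have "(fermat_poly + - 1 * mpoly_var i0 ^ n) ^ b * 1 \<in> J"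
      by (rule mod_F[THEN iffD2])
    then show ?thesis
      by (simp only: J'_def mem_Collect_eq subst_power F_eq mult_1_right)
  qed
  have "p dvd (\<Prod>j\<in>{1..n-1}. (j * m) choose m)"
    using n by (intro prime_dvd_multinomial[OF p q _ m ncong]) simp
  from linear_form_monomial_mem_ideal[where 'n = 'n and 'k = 'k, folded n_def p_def, OF n p q this J' S_def L_def b_def XJ' LJ']
  have "(\<Prod>i\<in>S. mpoly_var i) ^ ((n - 2) * m) * L ^ ((n - 2) * m) \<in> J'" .
  then have "(fermat_poly + - 1 * mpoly_var i0 ^ n) ^ a * (\<Prod>i\<in>S. mpoly_var i ^ n) ^ a \<in> J"
    unfolding J'_def mem_Collect_eq subst_mult subst_power subst_prod subst_mpoly_var F_eq
    by (simp only: s_def a_def mult.commute)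
  then have "(- 1 * mpoly_var i0 ^ n) ^ a * (\<Prod>i\<in>S. mpoly_var i ^ n) ^ a \<in> J"
    by (rule mod_F[THEN iffD1])
  \<comment> \<open>A second factor (-1)^a removes the sign.\<close>
  then have "(- 1) ^ a * ((- 1 * mpoly_var i0 ^ n) ^ a * (\<Prod>i\<in>S. mpoly_var i ^ n) ^ a) \<in> J"
    by (rule closed(3))
  also have "(- 1) ^ a * ((- 1 * mpoly_var i0 ^ n) ^ a * (\<Prod>i\<in>S. mpoly_var i ^ n) ^ a)
      = (mpoly_var i0 ^ n * (\<Prod>i\<in>S. mpoly_var i ^ n)) ^ a"
    unfolding power_mult_distrib by (simp add: mult.assoc[symmetric] power_mult_distrib[symmetric])
  also have "mpoly_var i0 ^ n * (\<Prod>i\<in>S. mpoly_var i ^ n) = (\<Prod>i\<in>UNIV. mpoly_var i ^ n)"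
    unfolding S_def by (rule prod.remove[symmetric]) auto
  also have "\<dots> = (\<Prod>i\<in>UNIV. mpoly_var i) ^ n"
    by (rule prod_power_distrib[symmetric])
  finally have "(\<Prod>i\<in>UNIV. mpoly_var i) ^ (n * a) \<in> J"
    by (simp add: power_mult)
  \<comment> \<open>Since p^e = n m + 1, the target exponent exceeds n a by n - 2.\<close>
  then have "(\<Prod>i\<in>UNIV. mpoly_var i) ^ (n - 2) * (\<Prod>i\<in>UNIV. mpoly_var i) ^ (n * a) \<in> J"
    by (rule closed(3))
  moreover have "(n - 2) * p ^ e = (n - 2) + n * a"
    unfolding q by (simp add: a_def n' algebra_simps)
  ultimately show ?thesis by (simp add: power_add)
qed

theorem theorem5p2:
  fixes n p :: nat
    and R :: "('n::finite, 'k::field) mpoly set ring"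
    and x :: "'n \<Rightarrow> ('n, 'k) mpoly set"
  assumes "n = CARD('n)" and "n \<ge> 3"
    and "p = CHAR('k)" and "prime p" and "\<not> p dvd n"
    and "R = fermat_ring" and "x = fermat_var"
  shows "(\<Otimes>\<^bsub>R\<^esub>i\<in>UNIV. x i) [^]\<^bsub>R\<^esub> (n - 2)
      \<in> frobenius_closure R p (Idl\<^bsub>R\<^esub> ((\<lambda>i. x i [^]\<^bsub>R\<^esub> (n - 1)) ` UNIV))
    \<longleftrightarrow> \<not> [p = 1] (mod n)"
proof -
  have prime: "prime CHAR('k)" using assms by simp
  have p1: "p > 1" using assms(4) by (rule prime_gt_1_nat)
  note iff = fermat_frobenius_closure_iff[OF prime, where 'n = 'n, of "n - 2" "n - 1", folded assms(3,6,7)]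
  show ?thesis
    unfolding iff
  proof
    assume "\<exists>e. \<forall>J :: ('n, 'k) mpoly set. ideal J mpoly_ring \<longrightarrow> fermat_poly \<in> J \<longrightarrow>
      (\<forall>i. mpoly_var i ^ ((n - 1) * p ^ e) \<in> J) \<longrightarrow> (\<Prod>i\<in>UNIV. mpoly_var i) ^ ((n - 2) * p ^ e) \<in> J"
    then obtain e where e: "\<And>J :: ('n, 'k) mpoly set. ideal J mpoly_ring \<Longrightarrow> fermat_poly \<in> J \<Longrightarrow>
      (\<And>i. mpoly_var i ^ ((n - 1) * p ^ e) \<in> J) \<Longrightarrow> (\<Prod>i\<in>UNIV. mpoly_var i) ^ ((n - 2) * p ^ e) \<in> J"
      by blast
    show "\<not> [p = 1] (mod n)"
    proof
      assume "[p = 1] (mod n)"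
      then have "n dvd p - 1" using p1 by (simp add: cong_altdef_nat)
      then obtain d where "p - 1 = n * d" by blast
      then have d: "p = n * d + 1" using p1 by linarith
      obtain J :: "('n, 'k) mpoly set" where
        "ideal J mpoly_ring" "fermat_poly \<in> J" "\<And>i. mpoly_var i ^ ((n - 1) * p ^ e) \<in> J"
        "(\<Prod>i\<in>UNIV. mpoly_var i) ^ ((n - 2) * p ^ e) \<notin> J"
        using prod_mpoly_var_notin_ideal[where 'n = 'n and 'k = 'k and e = e and d = d,
            folded assms(1,3)] assms(2,4) d by (metis Suc_leD numeral_2_eq_2 numeral_3_eq_3)
      then show False using e by blast
    qed
  next
    assume ncong: "\<not> [p = 1] (mod n)"
    \<comment> \<open>Euler's theorem gives p^e = n m + 1. Positivity of \<open>e\<close> ensures m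
      > 0; for m = 0 the multinomial coefficient would be 1.\<close>
    define e where "e = totient n"
    have "coprime p n" using assms(4,5) by (rule prime_imp_coprime_nat)
    then have "[p ^ e = 1] (mod n)" unfolding e_def by (rule euler_theorem)
    then have "n dvd p ^ e - 1" using p1 by (simp add: cong_altdef_nat)
    then obtain m where "p ^ e - 1 = n * m" by blast
    moreover have "e > 0" using assms(2) by (simp add: e_def)
    then have "p ^ e > 1" using p1 by (rule one_less_power[rotated])
    ultimately have m: "p ^ e = n * m + 1" "m > 0" by (linarith, (cases m; simp))
    show "\<exists>e. \<forall>J :: ('n, 'k) mpoly set. ideal J mpoly_ring \<longrightarrow> fermat_poly \<in> J \<longrightarrow>
      (\<forall>i. mpoly_var i ^ ((n - 1) * p ^ e) \<in> J) \<longrightarrow> (\<Prod>i\<in>UNIV. mpoly_var i) ^ ((n - 2) * p ^ e) \<in> J"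
      using prod_mpoly_var_mem_ideal[where 'n = 'n and 'k = 'k, folded assms(1,3), OF assms(2,4) m ncong]
      by blast
  qed
qed

end
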